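(* Let $T,\nu_1,\nu_2$ be positive real numbers with $\nu_1\le\nu_2$, and let $c:(0,T)\to\mathbb R$ be a measurable function satisfying $\nu_1\le c(t)\le\nu_2$ for almost every $t\in(0,T)$. Then there exists a constant $C>0$ such that $$\mathcal G(c,\lambda,T)\le C\left(1+\mathcal M_2\left((0,T),\frac1c,\lambda\right)\right)\qquad\forall\lambda>0.$$
   Context: Growth function: for $\lambda>0$ consider solutions $u_\lambda$ on $[0,T]$ of $u_\lambda''+\lambda^2c(t)^2u_\lambda=0$ (i.e. $u_\lambda\in C^1([0,T])$, $u_\lambda'$ absolutely continuous, equation satisfied almost everywhere), with energy $E_\lambda(t):=u_\lambda'(t)^2+\lambda^2u_\lambda(t)^2$. Then $$\mathcal G(c,\lambda,T):=\log\left(\sup\{E_\lambda(t):u_\lambda\text{ solution},\ E_\lambda(0)\le1,\ t\in[0,T]\}\right).$$ For $g\in L^1((0,T))$ and $\lambda>0$, $$\mathcal M_2((0,T),g,\lambda):=\inf_{\gamma\in C^2([0,T])}\left\{\frac1{\lambda}\int_0^T|\gamma''(x)|\,dx+\lambda\int_0^T|\gamma(x)-g(x)|\,dx\right\}.$$ The constant $C$ does not depend on $\lambda$. *)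

theory Defs
  imports "HOL-Analysis.Analysis"
begin

text \<open>
  Classical epsilon-delta absolute continuity on a compact interval. A division of a set is a finite
  family of nonempty compact intervals with pairwise disjoint interiors, so the pairs
  \<open>(Inf K, Sup K)\<close> range over all finite families of nonoverlapping subintervals.
\<close>

definition abs_continuous_on_interval :: "real \<Rightarrow> real \<Rightarrow> (real \<Rightarrow> real) \<Rightarrow> bool" where
  "abs_continuous_on_interval a b f \<longleftrightarrow>
     (\<forall>\<epsilon>>0. \<exists>\<delta>>0. \<forall>\<D> S. \<D> division_of S \<and> S \<subseteq> {a..b} \<and> (\<Sum>K\<in>\<D>. Sup K - Inf K) < \<delta> \<longrightarrow>
        (\<Sum>K\<in>\<D>. \<bar>f (Sup K) - f (Inf K)\<bar>) < \<epsilon>)"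

text \<open>
  \<open>f'\<close> is the derivative of \<open>f\<close> (one-sided at the end points) and is continuous. The derivative is
  carried along explicitly; for \<open>a < b\<close> it is determined by \<open>f\<close> on \<open>{a..b}\<close>.
\<close>

definition C1_on_with :: "real \<Rightarrow> real \<Rightarrow> (real \<Rightarrow> real) \<Rightarrow> (real \<Rightarrow> real) \<Rightarrow> bool" where
  "C1_on_with a b f f' \<longleftrightarrow>
     (\<forall>t\<in>{a..b}. (f has_real_derivative f' t) (at t within {a..b})) \<and> continuous_on {a..b} f'"

definition C2_on_with ::
    "real \<Rightarrow> real \<Rightarrow> (real \<Rightarrow> real) \<Rightarrow> (real \<Rightarrow> real) \<Rightarrow> (real \<Rightarrow> real) \<Rightarrow> bool" where
  "C2_on_with a b f f' f'' \<longleftrightarrow> C1_on_with a b f f' \<and> C1_on_with a b f' f''"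

definition wave_solution ::
    "(real \<Rightarrow> real) \<Rightarrow> real \<Rightarrow> real \<Rightarrow> (real \<Rightarrow> real) \<Rightarrow> (real \<Rightarrow> real) \<Rightarrow> bool" where
  "wave_solution c lam T u u' \<longleftrightarrow>
     C1_on_with 0 T u u' \<and>
     abs_continuous_on_interval 0 T u' \<and>
     (AE t in lebesgue_on {0<..<T}.
        \<exists>u''. (u' has_real_derivative u'') (at t) \<and> u'' + lam\<^sup>2 * (c t)\<^sup>2 * u t = 0)"

definition energy :: "real \<Rightarrow> (real \<Rightarrow> real) \<Rightarrow> (real \<Rightarrow> real) \<Rightarrow> real \<Rightarrow> real" where
  "energy lam u u' t = (u' t)\<^sup>2 + lam\<^sup>2 * (u t)\<^sup>2"

text \<open>
  The supremum is taken in the reals: for essentially bounded measurable \<open>c\<close> (the only case used) the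
  set of energies is bounded above by Gronwall's inequality, and it contains \<open>1\<close>.
\<close>

definition growth :: "(real \<Rightarrow> real) \<Rightarrow> real \<Rightarrow> real \<Rightarrow> real" where
  "growth c lam T =
     ln (Sup {energy lam u u' t | u u' t. wave_solution c lam T u u' \<and> energy lam u u' 0 \<le> 1 \<and> t \<in> {0..T}})"

text \<open>
  The measure is \<open>lebesgue\<close> rather than \<open>lborel\<close> because \<open>g\<close> is only Lebesgue measurable; the functional
  is meant for \<open>g\<close> integrable on \<open>(0, T)\<close>, where both integrals are finite for every \<open>\<gamma>\<close>.
\<close>

definition M2 :: "real \<Rightarrow> (real \<Rightarrow> real) \<Rightarrow> real \<Rightarrow> real" where
  "M2 T g lam =
     Inf {1 / lam * (LINT x:{0<..<T}|lebesgue. \<bar>\<gamma>'' x\<bar>) + lam * (LINT x:{0<..<T}|lebesgue. \<bar>\<gamma> x - g x\<bar>)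
          | \<gamma> \<gamma>' \<gamma>''. C2_on_with 0 T \<gamma> \<gamma>' \<gamma>''}"

end

theory Submission
  imports Defs
begin

text \<open>
  Fix a competitor \<open>\<gamma>\<close> and write \<open>g = 1 / c\<close>, \<open>r = \<bar>\<gamma>''\<bar> / \<lambda> + \<lambda> \<bar>\<gamma> - g\<bar>\<close>. Cut \<open>[0, T]\<close> into intervals of
  length \<open>h\<close>, a fixed large multiple of \<open>1 / \<lambda>\<close>. By Gronwall, the energy grows by at most a constant
  factor on each of them, which is affordable whenever the integral of \<open>r\<close> over the interval is at least
  some fixed \<open>\<epsilon>\<close>. If it is smaller than \<open>\<epsilon>\<close>, then \<open>\<gamma>\<close> is comparable to \<open>g\<close> and \<open>\<bar>\<gamma>'\<bar> \<le> \<lambda>\<close> on the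
  interval, and the second order adiabatic invariant
  \<open>F = \<gamma> u'\<^sup>2 - \<gamma>' u u' + (\<lambda>\<^sup>2 / \<gamma>) u\<^sup>2\<close> of the equation with speed \<open>1 / \<gamma>\<close> is comparable to the energy
  and satisfies \<open>\<bar>F'\<bar> \<le> const r F\<close>. Passing between \<open>F\<close> and the energy costs a constant factor, but
  happens only next to intervals of the first kind, so that the total growth is at most the exponential
  of a constant times \<open>1\<close> plus the integral of \<open>r\<close>.
\<close>

subsection \<open>Absolutely continuous functions\<close>

lemma abs_continuous_on_interval_subset:
  assumes "abs_continuous_on_interval a b f" "a \<le> a'" "b' \<le> b"
  shows "abs_continuous_on_interval a' b' f"
proof -
  have "S \<subseteq> {a..b}" if "S \<subseteq> {a'..b'}" for S :: "real set"
    using that assms(2,3) by fastforce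
  then show ?thesis
    using assms(1) unfolding abs_continuous_on_interval_def by meson
qed

lemma division_real_Sup_Inf:
  fixes S :: "real set"
  assumes "\<D> division_of S" "S \<subseteq> {a..b}" "K \<in> \<D>"
  shows "Inf K \<in> {a..b}" "Sup K \<in> {a..b}" "Inf K \<le> Sup K"
proof -
  obtain u v where K: "K = {u..v}" "K \<noteq> {}"
    using division_ofD(3,4)[OF assms(1,3)] by (metis box_real(2))
  moreover have "K \<subseteq> {a..b}"
    using division_ofD(2)[OF assms(1,3)] assms(2) by blast
  ultimately show "Inf K \<in> {a..b}" "Sup K \<in> {a..b}" "Inf K \<le> Sup K"
    by auto
qed

text \<open>Common source of the closure properties: Lipschitz functions, sums, differences,
  products and, later, the reciprocal of \<gamma> all satisfy such a bound on increments.\<close>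

lemma abs_continuous_on_interval_comb:
  assumes f: "abs_continuous_on_interval a b f" and g: "abs_continuous_on_interval a b g"
    and M: "\<And>x y. x \<in> {a..b} \<Longrightarrow> y \<in> {a..b} \<Longrightarrow> \<bar>h x - h y\<bar> \<le> M * (\<bar>f x - f y\<bar> + \<bar>g x - g y\<bar>)"
  shows "abs_continuous_on_interval a b h"
  unfolding abs_continuous_on_interval_def
proof (intro allI impI)
  fix e :: real assume "e > 0"
  \<comment> \<open>The maximum with 1 permits division even if \<open>M\<close> is zero or
    negative.\<close>
  define M' where "M' = max M 1"
  have M': "M' > 0" "M \<le> M'" by (auto simp: M'_def)
  with \<open>e > 0\<close> have e': "e / (2 * M') > 0" by simp
  obtain d1 where d1: "d1 > 0" "\<And>\<D> S. \<D> division_of S \<and> S \<subseteq> {a..b} \<and> (\<Sum>K\<in>\<D>. Sup K - Inf K) < d1 \<Longrightarrow>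
      (\<Sum>K\<in>\<D>. \<bar>f (Sup K) - f (Inf K)\<bar>) < e / (2 * M')"
    using f e' unfolding abs_continuous_on_interval_def by meson
  obtain d2 where d2: "d2 > 0" "\<And>\<D> S. \<D> division_of S \<and> S \<subseteq> {a..b} \<and> (\<Sum>K\<in>\<D>. Sup K - Inf K) < d2 \<Longrightarrow>
      (\<Sum>K\<in>\<D>. \<bar>g (Sup K) - g (Inf K)\<bar>) < e / (2 * M')"
    using g e' unfolding abs_continuous_on_interval_def by meson
  show "\<exists>\<delta>>0. \<forall>\<D> S. \<D> division_of S \<and> S \<subseteq> {a..b} \<and> (\<Sum>K\<in>\<D>. Sup K - Inf K) < \<delta> \<longrightarrow>
        (\<Sum>K\<in>\<D>. \<bar>h (Sup K) - h (Inf K)\<bar>) < e"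
  proof (intro exI[of _ "min d1 d2"] conjI allI impI)
    fix \<D> S assume D: "\<D> division_of S \<and> S \<subseteq> {a..b} \<and> (\<Sum>K\<in>\<D>. Sup K - Inf K) < min d1 d2"
    have "(\<Sum>K\<in>\<D>. \<bar>h (Sup K) - h (Inf K)\<bar>)
        \<le> (\<Sum>K\<in>\<D>. M' * (\<bar>f (Sup K) - f (Inf K)\<bar> + \<bar>g (Sup K) - g (Inf K)\<bar>))"
    proof (rule sum_mono)
      fix K assume "K \<in> \<D>"
      then have "\<bar>h (Sup K) - h (Inf K)\<bar> \<le> M * (\<bar>f (Sup K) - f (Inf K)\<bar> + \<bar>g (Sup K) - g (Inf K)\<bar>)"
        using division_real_Sup_Inf D by (intro M) blast+
      also have "\<dots> \<le> M' * (\<bar>f (Sup K) - f (Inf K)\<bar> + \<bar>g (Sup K) - g (Inf K)\<bar>)"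
        using M' by (intro mult_right_mono) auto
      finally show "\<bar>h (Sup K) - h (Inf K)\<bar> \<le> M' * (\<bar>f (Sup K) - f (Inf K)\<bar> + \<bar>g (Sup K) - g (Inf K)\<bar>)" .
    qed
    also have "\<dots> = M' * ((\<Sum>K\<in>\<D>. \<bar>f (Sup K) - f (Inf K)\<bar>) + (\<Sum>K\<in>\<D>. \<bar>g (Sup K) - g (Inf K)\<bar>))"
      by (simp only: sum_distrib_left sum.distrib distrib_left)
    also have "\<dots> < M' * (e / (2 * M') + e / (2 * M'))"
      using D d1(2)[of \<D> S] d2(2)[of \<D> S] M' by (intro mult_strict_left_mono add_strict_mono) auto
    also have "\<dots> = e" using M' by (simp add: field_simps)
    finally show "(\<Sum>K\<in>\<D>. \<bar>h (Sup K) - h (Inf K)\<bar>) < e" .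
  qed (use d1 d2 in auto)
qed

lemma abs_continuous_on_interval_id: "abs_continuous_on_interval a b (\<lambda>x. x)"
  unfolding abs_continuous_on_interval_def
proof (intro allI impI exI conjI)
  fix e :: real and \<D> and S :: "real set"
  assume D: "\<D> division_of S \<and> S \<subseteq> {a..b} \<and> (\<Sum>K\<in>\<D>. Sup K - Inf K) < e"
  have "(\<Sum>K\<in>\<D>. \<bar>Sup K - Inf K\<bar>) = (\<Sum>K\<in>\<D>. Sup K - Inf K)"
    using D division_real_Sup_Inf(3)[of \<D> S a b] by (intro sum.cong) auto
  with D show "(\<Sum>K\<in>\<D>. \<bar>Sup K - Inf K\<bar>) < e" by simp
qed

lemma abs_continuous_on_interval_lipschitz:
  assumes "\<And>x y. x \<in> {a..b} \<Longrightarrow> y \<in> {a..b} \<Longrightarrow> \<bar>f x - f y\<bar> \<le> M * \<bar>x - y\<bar>"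
  shows "abs_continuous_on_interval a b f"
  \<comment> \<open>The identity takes both places, so its increment counts twice and the constant
    is halved.\<close>
  by (rule abs_continuous_on_interval_comb[OF abs_continuous_on_interval_id
        abs_continuous_on_interval_id, where M = "M / 2"]) (use assms in auto)

lemma abs_continuous_on_interval_add:
  assumes "abs_continuous_on_interval a b f" "abs_continuous_on_interval a b g"
  shows "abs_continuous_on_interval a b (\<lambda>x. f x + g x)"
  by (rule abs_continuous_on_interval_comb[OF assms, where M = 1]) auto

lemma abs_continuous_on_interval_diff:
  assumes "abs_continuous_on_interval a b f" "abs_continuous_on_interval a b g"
  shows "abs_continuous_on_interval a b (\<lambda>x. f x - g x)"
  by (rule abs_continuous_on_interval_comb[OF assms, where M = 1]) auto

lemma continuous_on_Icc_abs_bound: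
  fixes f :: "real \<Rightarrow> real"
  assumes "continuous_on {a..b} f"
  obtains M where "M \<ge> 0" "\<And>x. x \<in> {a..b} \<Longrightarrow> \<bar>f x\<bar> \<le> M"
proof -
  have "bounded (f ` {a..b})"
    by (intro compact_imp_bounded compact_continuous_image assms compact_Icc)
  then obtain M where "M > 0" "\<And>y. y \<in> f ` {a..b} \<Longrightarrow> norm y \<le> M"
    unfolding bounded_pos by blast
  then show thesis by (intro that[of M]) auto
qed

lemma abs_continuous_on_interval_mult:
  assumes "abs_continuous_on_interval a b f" "abs_continuous_on_interval a b g"
    and cont: "continuous_on {a..b} f" "continuous_on {a..b} g"
  shows "abs_continuous_on_interval a b (\<lambda>x. f x * g x)"
proof -
  obtain A where A: "A \<ge> 0" "\<And>x. x \<in> {a..b} \<Longrightarrow> \<bar>f x\<bar> \<le> A"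
    using continuous_on_Icc_abs_bound[OF cont(1)] by blast
  obtain B where B: "B \<ge> 0" "\<And>x. x \<in> {a..b} \<Longrightarrow> \<bar>g x\<bar> \<le> B"
    using continuous_on_Icc_abs_bound[OF cont(2)] by blast
  show ?thesis
  proof (rule abs_continuous_on_interval_comb[OF assms(1,2), where M = "A + B"])
    fix x y assume xy: "x \<in> {a..b}" "y \<in> {a..b}"
    have "\<bar>f x * g x - f y * g y\<bar> = \<bar>(f x - f y) * g x + f y * (g x - g y)\<bar>"
      by (simp add: algebra_simps)
    also have "\<dots> \<le> \<bar>f x - f y\<bar> * \<bar>g x\<bar> + \<bar>f y\<bar> * \<bar>g x - g y\<bar>"
      by (metis abs_mult abs_triangle_ineq)
    also have "\<dots> \<le> \<bar>f x - f y\<bar> * (A + B) + (A + B) * \<bar>g x - g y\<bar>"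
      using A(1) B(1) A(2)[OF xy(2)] B(2)[OF xy(1)] by (intro add_mono mult_mono) auto
    finally show "\<bar>f x * g x - f y * g y\<bar> \<le> (A + B) * (\<bar>f x - f y\<bar> + \<bar>g x - g y\<bar>)"
      by (simp add: algebra_simps)
  qed
qed

section \<open>Functions of class C1 on a compact interval\<close>

lemma C1_on_with_subset:
  assumes "C1_on_with a b f f'" "a \<le> a'" "b' \<le> b"
  shows "C1_on_with a' b' f f'"
proof -
  have sub: "{a'..b'} \<subseteq> {a..b}" using assms by auto
  then show ?thesis
    using assms(1) unfolding C1_on_with_def
    by (meson DERIV_subset continuous_on_subset subset_iff)
qed

lemma C1_on_with_continuous:
  assumes "C1_on_with a b f f'" shows "continuous_on {a..b} f"
  using assms unfolding C1_on_with_def by (metis DERIV_continuous_on)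

lemma C1_on_with_DERIV:
  assumes "C1_on_with a b f f'" "x \<in> {a<..<b}" shows "(f has_real_derivative f' x) (at x)"
proof -
  have "(f has_real_derivative f' x) (at x within {a..b})"
    using assms unfolding C1_on_with_def by auto
  moreover have "at x within {a..b} = at x"
    using assms(2) by (intro at_within_Icc_at) auto
  ultimately show ?thesis by (simp only:)
qed

lemma C1_on_with_mean_value:
  assumes "C1_on_with a b f f'" "x \<in> {a..b}" "y \<in> {a..b}" "x < y"
  obtains z where "x < z" "z < y" "f y - f x = (y - x) * f' z"
proof -
  have "continuous_on {x..y} f"
    by (rule continuous_on_subset[OF C1_on_with_continuous[OF assms(1)]]) (use assms in auto)
  then obtain z where "x < z" "z < y" "f y - f x = f' z * (y - x)"
  proof (rule mvt[OF \<open>x < y\<close>])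
    show "(f has_derivative (*) (f' z)) (at z)" if "x < z" "z < y" for z
      using C1_on_with_DERIV[OF assms(1), of z] assms(2,3) that by (auto simp: has_field_derivative_def)
  qed
  then show thesis by (intro that[of z]) (simp_all add: mult.commute)
qed

lemma C1_on_with_lipschitz:
  assumes "C1_on_with a b f f'" and bound: "\<And>z. z \<in> {a..b} \<Longrightarrow> \<bar>f' z\<bar> \<le> M"
    and "x \<in> {a..b}" "y \<in> {a..b}"
  shows "\<bar>f x - f y\<bar> \<le> M * \<bar>x - y\<bar>"
proof -
  have *: "\<bar>f v - f u\<bar> \<le> M * \<bar>v - u\<bar>" if uv: "u \<in> {a..b}" "v \<in> {a..b}" "u < v" for u v
  proof -
    obtain z where z: "u < z" "z < v" "f v - f u = (v - u) * f' z"
      using C1_on_with_mean_value[OF assms(1) uv] by blast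
    moreover have "\<bar>f' z\<bar> \<le> M" using z uv by (intro bound) auto
    ultimately show ?thesis
      using uv(3) by (simp add: abs_mult mult.commute mult_left_mono)
  qed
  show ?thesis
  proof (cases x y rule: linorder_cases)
    case less
    then show ?thesis using *[OF assms(3,4)] by (simp only: abs_minus_commute)
  next
    case greater
    then show ?thesis using *[OF assms(4,3)] by simp
  qed simp
qed

lemma C1_on_with_abs_continuous:
  assumes "C1_on_with a b f f'" shows "abs_continuous_on_interval a b f"
proof -
  obtain M where M: "\<And>x. x \<in> {a..b} \<Longrightarrow> \<bar>f' x\<bar> \<le> M"
    using continuous_on_Icc_abs_bound[of a b f'] assms unfolding C1_on_with_def by blast
  show ?thesis
    by (rule abs_continuous_on_interval_lipschitz[OF C1_on_with_lipschitz[OF assms M]])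
qed

text \<open>
  On a fine tagged division the intervals with tag outside \<open>N\<close> are handled by differentiability, and
  those with tag in \<open>N\<close> have small total length, hence contribute little by absolute continuity.
\<close>

lemma fundamental_theorem_of_calculus_abs_continuous:
  fixes F f :: "real \<Rightarrow> real"
  assumes ab: "a \<le> b" and ac: "abs_continuous_on_interval a b F" and N: "negligible N"
    and deriv: "\<And>x. x \<in> {a..b} - N \<Longrightarrow> (F has_real_derivative f x) (at x within {a..b})"
  shows "(f has_integral (F b - F a)) {a..b}"
proof -
  \<comment> \<open>Nothing is known about \<open>f\<close> on \<open>N\<close>; the value 0 removes
    the Riemann terms tagged there, and the spike at the end restores \<open>f\<close>.\<close>
  define f0 where "f0 = (\<lambda>x. if x \<in> N then 0 else f x)"
  have "(f0 has_integral (F b - F a)) {a..b}"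
    unfolding has_integral_real
  proof (intro allI impI)
    fix e0 :: real assume e0: "e0 > 0"
    \<comment> \<open>Half of \<open>e0\<close> is reserved for the tags outside \<open>N\<close>;
      the summand 1 covers the case \<open>a = b\<close>.\<close>
    define e where "e = e0 / (2 * (b - a + 1))"
    have e: "e > 0" "e * (b - a) \<le> e0 / 2"
      using e0 ab by (auto simp: e_def field_simps)
    have "\<exists>d>0. x \<in> {a..b} - N \<longrightarrow> (\<forall>y\<in>{a..b}. \<bar>y - x\<bar> < d \<longrightarrow> \<bar>F y - F x - (y - x) * f x\<bar> \<le> e * \<bar>y - x\<bar>)" for x
    proof (cases "x \<in> {a..b} - N")
      case True
      then show ?thesis
        using deriv[OF True] e(1)
        unfolding has_field_derivative_def has_derivative_within_alt
        by (auto simp: mult.commute)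
    qed (auto intro!: exI[of _ 1])
    then obtain d where d: "\<And>x. 0 < d x"
      "\<And>x y. \<lbrakk>x \<in> {a..b} - N; y \<in> {a..b}; \<bar>y - x\<bar> < d x\<rbrakk> \<Longrightarrow> \<bar>F y - F x - (y - x) * f x\<bar> \<le> e * \<bar>y - x\<bar>"
      by metis
    obtain \<delta> where \<delta>: "\<delta> > 0" "\<And>\<D> S. \<D> division_of S \<and> S \<subseteq> {a..b} \<and> (\<Sum>K\<in>\<D>. Sup K - Inf K) < \<delta> \<Longrightarrow>
      (\<Sum>K\<in>\<D>. \<bar>F (Sup K) - F (Inf K)\<bar>) < e0 / 2"
      using ac half_gt_zero[OF e0] unfolding abs_continuous_on_interval_def by meson
    \<comment> \<open>The indicator of \<open>N\<close> has integral zero, and a gauge for it forces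
      the intervals tagged in \<open>N\<close> to have total length below \<delta>.\<close>
    have "((indicator N :: real \<Rightarrow> real) has_integral 0) {a..b}"
      using N unfolding negligible_def by (metis box_real(2))
    then obtain \<gamma> where \<gamma>: "gauge \<gamma>" "\<And>p. p tagged_division_of {a..b} \<and> \<gamma> fine p \<Longrightarrow>
        norm (sum (\<lambda>(x,k). measure lborel k *\<^sub>R (indicator N x::real)) p - 0) < \<delta>"
      using \<delta>(1) unfolding has_integral_real by meson
    show "\<exists>\<gamma>. gauge \<gamma> \<and> (\<forall>p. p tagged_division_of {a..b} \<and> \<gamma> fine p \<longrightarrow>
        norm (sum (\<lambda>(x,k). measure lborel k *\<^sub>R f0 x) p - (F b - F a)) < e0)"
    proof (intro exI[of _ "\<lambda>x. \<gamma> x \<inter> ball x (d x)"] conjI allI impI)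
      show "gauge (\<lambda>x. \<gamma> x \<inter> ball x (d x))"
        using \<gamma>(1) d(1) by (simp add: gauge_Int gauge_ball_dependent)
      fix p assume p: "p tagged_division_of {a..b} \<and> (\<lambda>x. \<gamma> x \<inter> ball x (d x)) fine p"
      then have tag: "p tagged_division_of {a..b}" and fin: "finite p"
        and fine: "\<gamma> fine p" "(\<lambda>x. ball x (d x)) fine p"
        by (auto simp: fine_Int)
      define q where "q = {(x, K) \<in> p. x \<in> N}"
      have q: "q tagged_division_of \<Union>(snd ` q)"
      proof (rule tagged_partial_division_of_Union_self)
        show "q tagged_partial_division_of {a..b}"
          by (rule tagged_partial_division_subset[of p]) (use tag in \<open>auto simp: q_def tagged_division_of_def\<close>)
      qed
      have K: "\<exists>u v. K = {u..v} \<and> u \<le> x \<and> x \<le> v \<and> a \<le> u \<and> v \<le> b" if xK: "(x, K) \<in> p" for x K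
      proof -
        obtain u v where "K = {u..v}"
          using tagged_division_ofD(4)[OF tag xK] by auto
        then show ?thesis
          using tagged_division_ofD(2,3)[OF tag xK] by auto
      qed
      have sum_q: "(\<Sum>(x, K)\<in>q. g K) = (\<Sum>K\<in>snd ` q. g K)"
        if "\<And>u v. v \<le> u \<Longrightarrow> g {u..v} = 0" for g :: "real set \<Rightarrow> real"
        by (rule sum.over_tagged_division_lemma[OF q]) (use that in auto)
      have sub: "\<Union>(snd ` q) \<subseteq> {a..b}"
        using tagged_division_ofD(3)[OF tag] by (fastforce simp: q_def)
      have "(\<Sum>K\<in>snd ` q. Sup K - Inf K) = (\<Sum>K\<in>snd ` q. measure lborel K)"
      proof (intro sum.cong refl)
        fix K assume "K \<in> snd ` q"
        then obtain x where "(x, K) \<in> p" by (auto simp: q_def)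
        from K[OF this] show "Sup K - Inf K = measure lborel K" by auto
      qed
      also have "\<dots> = (\<Sum>(x, K)\<in>q. measure lborel K)"
        by (rule sum_q[symmetric]) auto
      also have "\<dots> = (\<Sum>(x, K)\<in>p. measure lborel K *\<^sub>R indicator N x)"
        unfolding q_def using fin by (intro sum.mono_neutral_cong_left) (auto simp: indicator_def)
      also have "\<dots> < \<delta>" using \<gamma>(2)[of p] tag fine(1) by auto
      finally have small: "(\<Sum>K\<in>snd ` q. \<bar>F (Sup K) - F (Inf K)\<bar>) < e0 / 2"
        using \<delta>(2)[of "snd ` q" "\<Union>(snd ` q)"] division_of_tagged_division[OF q] sub by auto
      \<comment> \<open>\<open>sum_q\<close> asks for a summand vanishing on all intervals with
        empty interior, and \<open>Sup\<close> and \<open>Inf\<close> of the empty set are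
        unspecified.\<close>
      define g where "g = (\<lambda>K. if K = {} then 0 else \<bar>F (Sup K) - F (Inf K)\<bar>)"
      have gK: "g K = \<bar>F (Sup K) - F (Inf K)\<bar>" if "(x, K) \<in> p" for x K
        using K[OF that] by (auto simp: g_def)
      have "(\<Sum>K\<in>snd ` q. \<bar>F (Sup K) - F (Inf K)\<bar>) = (\<Sum>K\<in>snd ` q. g K)"
        by (intro sum.cong) (auto simp: q_def gK)
      also have "\<dots> = (\<Sum>(x, K)\<in>q. g K)"
        by (rule sum_q[symmetric]) (auto simp: g_def le_less)
      also have "\<dots> = (\<Sum>(x, K)\<in>p. if x \<in> N then \<bar>F (Sup K) - F (Inf K)\<bar> else 0)"
        unfolding q_def using fin by (intro sum.mono_neutral_cong_left) (auto simp: gK split: if_splits)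
      finally have small': "(\<Sum>(x, K)\<in>p. if x \<in> N then \<bar>F (Sup K) - F (Inf K)\<bar> else 0) < e0 / 2"
        using small by simp
      have "sum (\<lambda>(x,k). measure lborel k *\<^sub>R f0 x) p - (F b - F a)
          = sum (\<lambda>(x,k). measure lborel k *\<^sub>R f0 x) p - sum (\<lambda>(x,K). F (Sup K) - F (Inf K)) p"
        using additive_tagged_division_1[OF ab tag, of F] by simp
      also have "\<dots> = (\<Sum>(x,k)\<in>p. measure lborel k *\<^sub>R f0 x - (F (Sup k) - F (Inf k)))"
        by (simp add: sum_subtractf split_def)
      also have "norm \<dots> \<le> (\<Sum>(x,k)\<in>p. e * measure lborel k + (if x \<in> N then \<bar>F (Sup k) - F (Inf k)\<bar> else 0))"
      proof (rule sum_norm_le, safe)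
        fix x k assume xk: "(x, k) \<in> p"
        obtain u v where uv: "k = {u..v}" "u \<le> x" "x \<le> v" "a \<le> u" "v \<le> b"
          using K[OF xk] by blast
        have c: "measure lborel k = v - u" "Sup k = v" "Inf k = u" using uv by auto
        show "norm (measure lborel k *\<^sub>R f0 x - (F (Sup k) - F (Inf k)))
          \<le> e * measure lborel k + (if x \<in> N then \<bar>F (Sup k) - F (Inf k)\<bar> else 0)"
        proof (cases "x \<in> N")
          case True
          moreover have "0 \<le> e * (v - u)" using uv e(1) by simp
          ultimately show ?thesis unfolding c by (simp add: f0_def abs_minus_commute)
        next
          case False
          have "k \<subseteq> ball x (d x)" using fine(2) xk unfolding fine_def by auto
          moreover have "u \<in> k" "v \<in> k" using uv by auto
          ultimately have "\<bar>u - x\<bar> < d x" "\<bar>v - x\<bar> < d x"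
            by (auto simp: subset_iff dist_real_def)
          then have "\<bar>F u - F x - (u - x) * f x\<bar> \<le> e * \<bar>u - x\<bar>"
            "\<bar>F v - F x - (v - x) * f x\<bar> \<le> e * \<bar>v - x\<bar>"
            using d(2)[of x u] d(2)[of x v] uv False by auto
          \<comment> \<open>The increment over the interval is split at its tag \<open>x\<close>,
            where the differentiability estimate is available.\<close>
          moreover have "(v - u) * f x - (F v - F u) = (F u - F x - (u - x) * f x) - (F v - F x - (v - x) * f x)"
            by (simp add: algebra_simps)
          ultimately have "\<bar>(v - u) * f x - (F v - F u)\<bar> \<le> e * \<bar>u - x\<bar> + e * \<bar>v - x\<bar>"
            by linarith
          also have "\<dots> = e * (v - u)" using uv(2,3) by (simp add: algebra_simps)
          finally show ?thesis using False unfolding c by (simp add: f0_def)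
        qed
      qed
      also have "\<dots> = e * (\<Sum>(x,k)\<in>p. measure lborel k) + (\<Sum>(x, K)\<in>p. if x \<in> N then \<bar>F (Sup K) - F (Inf K)\<bar> else 0)"
        by (simp add: sum.distrib sum_distrib_left split_def)
      also have "(\<Sum>(x,k)\<in>p. measure lborel k) = b - a"
        using additive_content_tagged_division[of p a b] tag ab by simp
      also have "e * (b - a) + (\<Sum>(x, K)\<in>p. if x \<in> N then \<bar>F (Sup K) - F (Inf K)\<bar> else 0) < e0"
        using small' e(2) by linarith
      finally show "norm (sum (\<lambda>(x,k). measure lborel k *\<^sub>R f0 x) p - (F b - F a)) < e0" .
    qed
  qed
  then show ?thesis
    by (rule has_integral_spike[OF N, rotated]) (auto simp: f0_def)
qed

subsection \<open>Energy growth of a solution\<close>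

text \<open>Integrates a derivative bound known only almost everywhere. It serves three times: for
  the energy, for \<open>F\<close> and for \<gamma>'.\<close>

lemma abs_continuous_oscillation:
  fixes F h :: "real \<Rightarrow> real"
  assumes ac: "abs_continuous_on_interval a b F" and N: "negligible N"
    and deriv: "\<And>t. t \<in> {a<..<b} - N \<Longrightarrow> \<exists>d. (F has_real_derivative d) (at t) \<and> \<bar>d\<bar> \<le> h t"
    and h: "h integrable_on {a..b}" "\<And>t. t \<in> {a..b} \<Longrightarrow> 0 \<le> h t"
    and xy: "x \<in> {a..b}" "y \<in> {a..b}"
  shows "\<bar>F y - F x\<bar> \<le> integral {a..b} h"
proof -
  have *: "\<bar>F y - F x\<bar> \<le> integral {a..b} h" if xy: "x \<in> {a..b}" "y \<in> {a..b}" "x \<le> y" for x y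
  proof -
    \<comment> \<open>Derivatives are controlled only inside the open interval, and \<open>x\<close>
      or \<open>y\<close> may be an end point, so both join the exceptional set.\<close>
    define f where "f = (\<lambda>t. if t \<in> N \<union> {x, y} then 0 else deriv F t)"
    have D: "(F has_real_derivative f t) (at t)" "\<bar>f t\<bar> \<le> h t" if "t \<in> {x..y} - (N \<union> {x, y})" for t
      using deriv[of t] that xy by (auto simp: f_def DERIV_imp_deriv)
    have "(f has_integral (F y - F x)) {x..y}"
    proof (rule fundamental_theorem_of_calculus_abs_continuous[where N = "N \<union> {x, y}"])
      show "abs_continuous_on_interval x y F"
        using abs_continuous_on_interval_subset[OF ac] xy by simp
      show "(F has_real_derivative f t) (at t within {x..y})" if "t \<in> {x..y} - (N \<union> {x, y})" for t
        using D(1)[OF that] by (rule has_field_derivative_at_within)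
    qed (use xy N in auto)
    then have f: "f integrable_on {x..y}" "integral {x..y} f = F y - F x"
      by (auto simp: integral_unique integrable_on_def)
    have sub: "{x..y} \<subseteq> {a..b}" using xy by auto
    have hxy: "h integrable_on {x..y}" by (rule integrable_subinterval_real[OF h(1) sub])
    have "norm (integral {x..y} f) \<le> integral {x..y} h"
    proof (rule integral_norm_bound_integral[OF f(1) hxy])
      fix t assume t: "t \<in> {x..y}"
      show "norm (f t) \<le> h t"
      proof (cases "t \<in> N \<union> {x, y}")
        case True
        then show ?thesis using h(2)[of t] t sub by (auto simp: f_def)
      qed (use D(2) t in auto)
    qed
    also have "\<dots> \<le> integral {a..b} h"
      by (rule integral_subset_le[OF sub hxy h(1)]) (use h(2) in blast)
    finally show ?thesis using f(2) by simp
  qed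
  show ?thesis
  proof (cases "x \<le> y")
    case True then show ?thesis using * xy by simp
  next
    case False
    then have "\<bar>F x - F y\<bar> \<le> integral {a..b} h" using * xy by simp
    then show ?thesis by (simp only: abs_minus_commute)
  qed
qed

text \<open>The hypothesis is in integral form because the energy is differentiable only almost
  everywhere. The integral \<open>I\<close> of the continuous \<open>E\<close> is differentiable at
  every interior point, and \<open>G\<close> is nonincreasing.\<close>

lemma gronwall_continuous:
  fixes E :: "real \<Rightarrow> real"
  assumes cont: "continuous_on {a..b} E" and ab: "a \<le> b" and K: "K \<ge> 0"
    and le: "\<And>t. t \<in> {a..b} \<Longrightarrow> E t \<le> A + K * integral {a..t} E"
  shows "E b \<le> A * exp (K * (b - a))"
proof -
  define I where "I = (\<lambda>t. integral {a..t} E)"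
  define G where "G = (\<lambda>t. exp (- K * (t - a)) * (A + K * I t))"
  have "continuous_on {a..b} I"
    unfolding I_def by (intro indefinite_integral_continuous_1 integrable_continuous_interval cont)
  then have contG: "continuous_on {a..b} G"
    unfolding G_def by (intro continuous_intros)
  have "G b \<le> G a"
  proof (rule DERIV_nonpos_imp_decreasing_open[OF ab _ contG])
    fix t assume t: "a < t" "t < b"
    have "(I has_real_derivative E t) (at t within {a..b})"
      unfolding I_def using t by (intro integral_has_real_derivative cont) auto
    moreover have "at t within {a..b} = at t" using t by (intro at_within_Icc_at)
    ultimately have I: "(I has_real_derivative E t) (at t)" by (simp only:)
    have "(G has_real_derivative exp (- K * (t - a)) * (K * (E t - (A + K * I t)))) (at t)"
      unfolding G_def by (rule derivative_eq_intros I refl)+ (simp add: algebra_simps)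
    moreover have "exp (- K * (t - a)) * (K * (E t - (A + K * I t))) \<le> 0"
      using le[of t] t K by (intro mult_nonneg_nonpos) (auto simp: I_def)
    ultimately show "\<exists>y. DERIV G t :> y \<and> y \<le> 0" by blast
  qed
  then have "exp (- K * (b - a)) * (A + K * I b) \<le> A"
    by (simp add: G_def I_def)
  moreover have "exp (- K * (b - a)) = 1 / exp (K * (b - a))"
    by (simp add: exp_minus divide_inverse)
  ultimately have "A + K * I b \<le> exp (K * (b - a)) * A"
    by (simp add: divide_le_eq mult.commute)
  with le[of b] ab show ?thesis by (simp add: I_def mult.commute)
qed

section \<open>Pointwise estimates for the energy and the quadratic form\<close>

lemma two_mult_le_energy:
  fixes p q lam :: real
  assumes "lam > 0"
  shows "2 * lam * \<bar>p * q\<bar> \<le> q\<^sup>2 + lam\<^sup>2 * p\<^sup>2"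
proof -
  have "0 \<le> (\<bar>q\<bar> - lam * \<bar>p\<bar>)\<^sup>2" by simp
  also have "\<dots> = q\<^sup>2 + lam\<^sup>2 * p\<^sup>2 - 2 * lam * \<bar>p * q\<bar>"
    by (simp add: power2_diff power_mult_distrib abs_mult)
  finally show ?thesis by simp
qed

text \<open>Since \<bar>G1\<bar> \<le> lam, the arithmetic-geometric inequality for \<open>p\<close>
  and \<open>G * q\<close> bounds the mixed term by half of the diagonal part \<open>X\<close>.
  Hence \<open>F\<close> lies between \<open>X / 2\<close> and \<open>2 * X\<close>, and
  \<open>m\<close> is large enough to compare both with the energy.\<close>

lemma quadratic_form_comparison:
  fixes p q lam G G1 g0 g1 :: real
  assumes lam: "lam > 0" and g0: "0 < g0" and G: "g0 / 2 \<le> G" "G \<le> 2 * g1" and G1: "\<bar>G1\<bar> \<le> lam"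
  defines "F \<equiv> G * q\<^sup>2 - G1 * p * q + lam\<^sup>2 / G * p\<^sup>2" and "m \<equiv> 4 * g1 + 4 / g0"
  shows "q\<^sup>2 + lam\<^sup>2 * p\<^sup>2 \<le> m * F" and "F \<le> m * (q\<^sup>2 + lam\<^sup>2 * p\<^sup>2)"
proof -
  have pos: "G > 0" "g1 > 0" using g0 G by linarith+
  define X where "X = G * q\<^sup>2 + lam\<^sup>2 / G * p\<^sup>2"
  have X0: "X \<ge> 0" using pos by (simp add: X_def)
  have cross: "2 * \<bar>G1 * p * q\<bar> \<le> X"
  proof -
    have "2 * \<bar>G1 * p * q\<bar> \<le> 2 * lam * \<bar>p * q\<bar>"
      using G1 by (simp add: abs_mult mult_right_mono mult.assoc)
    also have "\<dots> = 2 * (lam / G) * \<bar>p * (G * q)\<bar>" using pos by (simp add: abs_mult)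
    also have "\<dots> = 2 * lam * \<bar>p * (G * q)\<bar> / G" by simp
    also have "\<dots> \<le> ((G * q)\<^sup>2 + lam\<^sup>2 * p\<^sup>2) / G"
      using two_mult_le_energy[OF lam, of p "G * q"] pos by (intro divide_right_mono) auto
    also have "\<dots> = X" using pos by (simp add: X_def add_divide_distrib power2_eq_square)
    finally show ?thesis .
  qed
  have m1: "1 \<le> (m / 2) * G"
  proof -
    have "1 = (2 / g0) * (g0 / 2)" using g0 by simp
    also have "\<dots> \<le> (m / 2) * G" using g0 G pos by (intro mult_mono) (auto simp: m_def)
    finally show ?thesis .
  qed
  have m2: "1 \<le> (m / 2) / G"
    using G g0 pos by (simp add: m_def le_divide_eq)
      (smt (verit) divide_pos_pos)
  have m3: "2 * G \<le> m" using G g0 by (simp add: m_def) (smt (verit) divide_pos_pos)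
  have m4: "2 / G \<le> m"
  proof -
    have "2 / G \<le> 2 / (g0 / 2)" using G g0 pos by (intro divide_left_mono) auto
    also have "\<dots> \<le> m" using pos by (simp add: m_def)
    finally show ?thesis .
  qed
  have Feq: "F = X - G1 * p * q" by (simp add: F_def X_def)
  have "X \<le> 2 * F" using cross Feq by linarith
  have m0: "m \<ge> 0" using pos g0 by (simp add: m_def)
  have "1 * q\<^sup>2 + 1 * (lam\<^sup>2 * p\<^sup>2) \<le> (m / 2) * G * q\<^sup>2 + (m / 2) / G * (lam\<^sup>2 * p\<^sup>2)"
    by (intro add_mono mult_right_mono m1 m2) auto
  also have "\<dots> = (m / 2) * X" by (simp add: X_def algebra_simps)
  also have "\<dots> \<le> (m / 2) * (2 * F)" using \<open>X \<le> 2 * F\<close> m0 by (intro mult_left_mono) auto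
  finally show "q\<^sup>2 + lam\<^sup>2 * p\<^sup>2 \<le> m * F" by simp
  have "F \<le> 2 * X" using cross Feq X0 by linarith
  also have "2 * X = (2 * G) * q\<^sup>2 + (2 / G) * (lam\<^sup>2 * p\<^sup>2)" by (simp add: X_def algebra_simps)
  also have "\<dots> \<le> m * q\<^sup>2 + m * (lam\<^sup>2 * p\<^sup>2)"
    by (intro add_mono mult_right_mono m3 m4) auto
  finally show "F \<le> m * (q\<^sup>2 + lam\<^sup>2 * p\<^sup>2)" by (simp add: algebra_simps)
qed

text \<open>
  The left-hand side is the derivative of the form \<open>F\<close> of the previous lemma along a solution:
  \<open>p' = q\<close>, \<open>q' = - (lam / g)\<^sup>2 p\<close>, \<open>G' = G1\<close>, \<open>G1' = G2\<close>.
\<close>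

lemma quadratic_form_derivative_bound:
  fixes p q lam G G1 G2 g g0 g1 :: real
  assumes lam: "lam > 0" and g0: "0 < g0" and g: "g0 \<le> g" "g \<le> g1"
    and G: "g0 / 2 \<le> G" "G \<le> 2 * g1" and G1: "\<bar>G1\<bar> \<le> lam"
  shows "\<bar>p * q * (2 * lam\<^sup>2 * (1 / G - G / g\<^sup>2) - G2) + lam\<^sup>2 * G1 * (1 / g\<^sup>2 - 1 / G\<^sup>2) * p\<^sup>2\<bar>
    \<le> (1 + 6 * g1 / g0 ^ 3 + 12 * g1 / g0 ^ 4) * (\<bar>G2\<bar> / lam + lam * \<bar>G - g\<bar>) * (q\<^sup>2 + lam\<^sup>2 * p\<^sup>2)"
proof -
  have pos: "G > 0" "g > 0" "g1 > 0" using g0 g G by linarith+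
  define E where "E = q\<^sup>2 + lam\<^sup>2 * p\<^sup>2"
  \<comment> \<open>Both differences below have numerator at most \<open>3 * g1\<close> times
    \<bar>G - g\<bar>; the denominators are at least \<open>g0 ^ 3 / 2\<close> and
    \<open>g0 ^ 4 / 4\<close>, whence the factors 6 and 12.\<close>
  define A where "A = 6 * g1 / g0 ^ 3"
  define B where "B = 12 * g1 / g0 ^ 4"
  have AB: "A \<ge> 0" "B \<ge> 0" using g0 pos by (auto simp: A_def B_def)
  have E: "2 * lam * \<bar>p * q\<bar> \<le> E" "lam\<^sup>2 * p\<^sup>2 \<le> E" "0 \<le> E"
    using two_mult_le_energy[OF lam, of p q] by (auto simp: E_def)
  have s: "\<bar>g + G\<bar> \<le> 3 * g1" using g G pos by auto
  have 1: "\<bar>1 / G - G / g\<^sup>2\<bar> \<le> A * \<bar>G - g\<bar>"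
  proof -
    have "1 / G - G / g\<^sup>2 = (g - G) * (g + G) / (G * g\<^sup>2)"
      using pos by (simp add: field_simps power2_eq_square)
    then have "\<bar>1 / G - G / g\<^sup>2\<bar> = \<bar>G - g\<bar> * \<bar>g + G\<bar> / (G * g\<^sup>2)"
      using pos by (simp add: abs_mult abs_minus_commute)
    also have "\<dots> \<le> \<bar>G - g\<bar> * (3 * g1) / ((g0 / 2) * g0\<^sup>2)"
      using s G g g0 pos by (intro frac_le mult_left_mono mult_mono power_mono) auto
    also have "\<dots> = A * \<bar>G - g\<bar>" by (simp add: A_def power2_eq_square power3_eq_cube mult_ac)
    finally show ?thesis .
  qed
  have 2: "\<bar>1 / g\<^sup>2 - 1 / G\<^sup>2\<bar> \<le> B * \<bar>G - g\<bar>"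
  proof -
    have "1 / g\<^sup>2 - 1 / G\<^sup>2 = (G - g) * (g + G) / (g\<^sup>2 * G\<^sup>2)"
      using pos by (simp add: field_simps power2_eq_square)
    then have "\<bar>1 / g\<^sup>2 - 1 / G\<^sup>2\<bar> = \<bar>G - g\<bar> * \<bar>g + G\<bar> / (g\<^sup>2 * G\<^sup>2)"
      using pos by (simp add: abs_mult)
    also have "\<dots> \<le> \<bar>G - g\<bar> * (3 * g1) / (g0\<^sup>2 * (g0 / 2)\<^sup>2)"
      using s G g g0 pos by (intro frac_le mult_left_mono mult_mono power_mono) auto
    also have "\<dots> = B * \<bar>G - g\<bar>" by (simp add: B_def power2_eq_square power4_eq_xxxx mult_ac)
    finally show ?thesis .
  qed
  have "\<bar>p * q * (2 * lam\<^sup>2 * (1 / G - G / g\<^sup>2) - G2)\<bar>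
      = (2 * lam * \<bar>p * q\<bar>) * \<bar>lam * (1 / G - G / g\<^sup>2) - G2 / (2 * lam)\<bar>"
  proof -
    have *: "p * q * (2 * lam\<^sup>2 * (1 / G - G / g\<^sup>2) - G2)
      = (2 * lam * (p * q)) * (lam * (1 / G - G / g\<^sup>2) - G2 / (2 * lam))"
      using lam by (simp add: field_simps power2_eq_square)
    show ?thesis unfolding * abs_mult[of "2 * lam * (p * q)"] using lam by (simp add: abs_mult)
  qed
  also have "\<dots> \<le> E * (lam * (A * \<bar>G - g\<bar>) + \<bar>G2\<bar> / lam)"
  proof (intro mult_mono E(1,3))
    have "\<bar>lam * (1 / G - G / g\<^sup>2)\<bar> \<le> lam * (A * \<bar>G - g\<bar>)"
      using lam 1 by (simp add: abs_mult)
    moreover have "\<bar>G2 / (2 * lam)\<bar> \<le> \<bar>G2\<bar> / lam"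
      using lam by (simp add: abs_mult field_simps)
    ultimately show "\<bar>lam * (1 / G - G / g\<^sup>2) - G2 / (2 * lam)\<bar> \<le> lam * (A * \<bar>G - g\<bar>) + \<bar>G2\<bar> / lam"
      by linarith
  qed auto
  finally have I: "\<bar>p * q * (2 * lam\<^sup>2 * (1 / G - G / g\<^sup>2) - G2)\<bar> \<le> E * (lam * (A * \<bar>G - g\<bar>) + \<bar>G2\<bar> / lam)" .
  \<comment> \<open>One factor \<open>lam\<close> in the result comes from \<bar>G1\<bar> \<le> lam,
    the other two are absorbed in the energy.\<close>
  have "\<bar>lam\<^sup>2 * G1 * (1 / g\<^sup>2 - 1 / G\<^sup>2) * p\<^sup>2\<bar> = (lam\<^sup>2 * p\<^sup>2) * (\<bar>G1\<bar> * \<bar>1 / g\<^sup>2 - 1 / G\<^sup>2\<bar>)"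
    by (simp add: abs_mult)
  also have "\<dots> \<le> E * (lam * (B * \<bar>G - g\<bar>))"
    using lam by (intro mult_mono E 2 G1) auto
  finally have II: "\<bar>lam\<^sup>2 * G1 * (1 / g\<^sup>2 - 1 / G\<^sup>2) * p\<^sup>2\<bar> \<le> E * (lam * (B * \<bar>G - g\<bar>))" .
  have *: "A * y + z + B * y \<le> (1 + A + B) * (z + y)" if "0 \<le> y" "0 \<le> z" for y z :: real
  proof -
    have "0 \<le> A * z" "0 \<le> B * z" using AB that by auto
    with that show ?thesis by (simp add: algebra_simps)
  qed
  have "\<bar>p * q * (2 * lam\<^sup>2 * (1 / G - G / g\<^sup>2) - G2) + lam\<^sup>2 * G1 * (1 / g\<^sup>2 - 1 / G\<^sup>2) * p\<^sup>2\<bar>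
      \<le> E * (lam * (A * \<bar>G - g\<bar>) + \<bar>G2\<bar> / lam) + E * (lam * (B * \<bar>G - g\<bar>))"
    using I II by linarith
  also have "\<dots> = E * (A * (lam * \<bar>G - g\<bar>) + \<bar>G2\<bar> / lam + B * (lam * \<bar>G - g\<bar>))"
    by (simp only: distrib_left mult.left_commute)
  also have "\<dots> \<le> E * ((1 + A + B) * (\<bar>G2\<bar> / lam + lam * \<bar>G - g\<bar>))"
    using E(3) lam by (intro mult_left_mono *) auto
  finally show ?thesis
    unfolding E_def[symmetric] A_def[symmetric] B_def[symmetric] by (simp only: mult.commute)
qed

text \<open>Turns an absorbed estimate, with a factor \<open>1 - x\<close> on the left, into
  exponential growth. The point is that
  \<open>(1 - x) * (1 + 2 * x) = 1 + x * (1 - 2 * x)\<close>.\<close>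

lemma one_le_exp_2x:
  fixes x :: real
  assumes "0 \<le> x" "x \<le> 1 / 2"
  shows "1 \<le> (1 - x) * exp (2 * x)"
proof -
  have "0 \<le> x * (1 - 2 * x)" using assms by simp
  then have "1 \<le> (1 - x) * (1 + 2 * x)" by (simp add: algebra_simps)
  also have "\<dots> \<le> (1 - x) * exp (2 * x)"
    using assms exp_ge_add_one_self[of "2 * x"] by (intro mult_left_mono) auto
  finally show ?thesis .
qed

section \<open>A solution compared with a fixed competitor\<close>

text \<open>Here \<open>g\<close> stands for a truncation of \<open>1 / c\<close> that obeys the
  bounds everywhere, and \<open>N\<close> contains the points where the equation may fail. The
  constants \<open>m\<close>, \<kappa>, \<epsilon>, \<open>K\<close> and \<open>A\<close> below
  depend on \<open>g0\<close> and \<open>g1\<close> only, which makes the final bound uniform in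
  \<open>lam\<close>, the solution and the competitor.\<close>

locale wave_comparison =
  fixes T lam g0 g1 :: real and u u' \<gamma> \<gamma>' \<gamma>'' g :: "real \<Rightarrow> real" and N :: "real set"
  assumes lam: "lam > 0" and g0: "0 < g0"
    and g_bounds: "g0 \<le> g t" "g t \<le> g1"
    and u_C1: "C1_on_with 0 T u u'"
    and u'_ac: "abs_continuous_on_interval 0 T u'"
    and N: "negligible N"
    and u'_deriv: "t \<in> {0<..<T} - N \<Longrightarrow> (u' has_real_derivative - (lam\<^sup>2 * u t / (g t)\<^sup>2)) (at t)"
    and \<gamma>_C1: "C1_on_with 0 T \<gamma> \<gamma>'"
    and \<gamma>'_C1: "C1_on_with 0 T \<gamma>' \<gamma>''"
    and r_integrable: "(\<lambda>t. \<bar>\<gamma>'' t\<bar> / lam + lam * \<bar>\<gamma> t - g t\<bar>) integrable_on {0..T}"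
begin

definition r where "r t = \<bar>\<gamma>'' t\<bar> / lam + lam * \<bar>\<gamma> t - g t\<bar>"

abbreviation E where "E \<equiv> energy lam u u'"

definition F where "F t = \<gamma> t * (u' t)\<^sup>2 - \<gamma>' t * u t * u' t + lam\<^sup>2 / \<gamma> t * (u t)\<^sup>2"

definition good where "good t \<longleftrightarrow> g0 / 2 \<le> \<gamma> t \<and> \<gamma> t \<le> 2 * g1 \<and> \<bar>\<gamma>' t\<bar> \<le> lam"

definition m where "m = 4 * g1 + 4 / g0"

text \<open>The factor \<open>m\<close> pays for replacing the energy by \<open>F\<close> in the
  bound on the derivative of \<open>F\<close>.\<close>

definition \<kappa> where "\<kappa> = (1 + 6 * g1 / g0 ^ 3 + 12 * g1 / g0 ^ 4) * m"

text \<open>Three thresholds: 1/2 keeps the variation of \<gamma>' below \<open>lam / 2\<close>;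
  \<open>g0\<^sup>2 / 32\<close> provides a point where \<gamma> is near the range of
  \<open>g\<close> in every subinterval of length \<open>g0 / (8 * lam)\<close>;
  \<open>1 / (2 * \<kappa>)\<close> allows the absorption in \<open>good_growth\<close>.\<close>

definition \<epsilon> where "\<epsilon> = min (1 / 2) (min (g0\<^sup>2 / 32) (1 / (2 * \<kappa>)))"

lemma g1: "g0 \<le> g1" "0 < g1"
  using g_bounds[of 0] g0 by linarith+

lemma r_nonneg: "0 \<le> r t"
  using lam by (simp add: r_def)

lemma r_integrable_on: "0 \<le> a \<Longrightarrow> b \<le> T \<Longrightarrow> r integrable_on {a..b}"
  using r_integrable unfolding r_def[abs_def, symmetric]
  by (rule integrable_subinterval_real) auto

lemma m: "1 \<le> m"
proof -
  have "1 \<le> g0 + 1 / g0"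
  proof (cases "g0 \<ge> 1")
    case True then show ?thesis using g0 by (simp add: add_increasing2)
  next
    case False then show ?thesis using g0 by (simp add: add_increasing le_divide_eq)
  qed
  also have "g0 + 1 / g0 \<le> m"
    using g1 g0 by (simp add: m_def) (smt (verit) divide_right_mono)
  finally show ?thesis .
qed

lemma \<kappa>: "1 \<le> \<kappa>"
proof -
  have "1 * 1 \<le> \<kappa>" unfolding \<kappa>_def using g0 g1 m by (intro mult_mono) auto
  then show ?thesis by simp
qed

lemma \<epsilon>: "0 < \<epsilon>" "\<epsilon> \<le> 1 / 2" "\<epsilon> \<le> g0\<^sup>2 / 32" "\<epsilon> \<le> 1 / (2 * \<kappa>)"
  using g0 \<kappa> by (auto simp: \<epsilon>_def)

lemma E_nonneg: "0 \<le> E t"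
  by (simp add: energy_def)

lemma E_ac:
  assumes "0 \<le> a" "b \<le> T"
  shows "abs_continuous_on_interval a b E" "continuous_on {a..b} E"
proof -
  have u: "C1_on_with a b u u'" by (rule C1_on_with_subset[OF u_C1 assms])
  note ac = abs_continuous_on_interval_subset[OF u'_ac assms] C1_on_with_abs_continuous[OF u]
  note cont = C1_on_with_continuous[OF u] u[unfolded C1_on_with_def, THEN conjunct2]
  have const: "abs_continuous_on_interval a b (\<lambda>t. lam\<^sup>2)"
    by (rule abs_continuous_on_interval_lipschitz[where M = 0]) auto
  have "abs_continuous_on_interval a b (\<lambda>t. u' t * u' t + lam\<^sup>2 * (u t * u t))"
    by (intro abs_continuous_on_interval_add abs_continuous_on_interval_mult ac cont const continuous_intros)
  then show "abs_continuous_on_interval a b E"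
    by (simp add: energy_def[abs_def] power2_eq_square)
  show "continuous_on {a..b} E"
    unfolding energy_def[abs_def] by (intro continuous_intros cont)
qed

text \<open>The derivative of the energy is
  \<open>2 * lam\<^sup>2 * (1 - 1 / g\<^sup>2) * u * u'\<close>, of order \<open>lam\<close> times
  the energy. Over a length of order \<open>1 / lam\<close> the growth factor therefore does not
  depend on \<open>lam\<close>.\<close>

lemma crude_growth:
  assumes ab: "0 \<le> a" "a \<le> b" "b \<le> T"
  shows "E b \<le> E a * exp ((1 + 1 / g0\<^sup>2) * lam * (b - a))"
proof (rule gronwall_continuous[OF E_ac(2)])
  show "0 \<le> (1 + 1 / g0\<^sup>2) * lam" using lam by simp
  fix t assume t: "t \<in> {a..b}"
  have intE: "E integrable_on {a..t}"
    by (rule integrable_continuous_interval, rule E_ac) (use ab t in auto)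
  have "\<bar>E t - E a\<bar> \<le> integral {a..t} (\<lambda>s. (1 + 1 / g0\<^sup>2) * lam * E s)"
  proof (rule abs_continuous_oscillation[OF E_ac(1) N])
    show "(\<lambda>s. (1 + 1 / g0\<^sup>2) * lam * E s) integrable_on {a..t}"
      using integrable_cmul[OF intE] by simp
    fix s assume s: "s \<in> {a<..<t} - N"
    have u: "(u has_real_derivative u' s) (at s)"
      by (rule C1_on_with_DERIV[OF u_C1]) (use s ab t in auto)
    have u': "(u' has_real_derivative - (lam\<^sup>2 * u s / (g s)\<^sup>2)) (at s)"
      by (rule u'_deriv) (use s ab t in auto)
    define d where "d = (1 - 1 / (g s)\<^sup>2) * lam * (2 * lam * (u s * u' s))"
    have "(E has_real_derivative d) (at s)"
      unfolding energy_def[abs_def] d_def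
      by (rule derivative_eq_intros u u' refl)+ (simp add: algebra_simps power2_eq_square)
    moreover have "\<bar>d\<bar> \<le> (1 + 1 / g0\<^sup>2) * lam * E s"
    proof -
      have "1 / (g s)\<^sup>2 \<le> 1 / g0\<^sup>2"
        using g0 g_bounds[of s] by (intro divide_left_mono power_mono mult_pos_pos) auto
      then have c: "\<bar>1 - 1 / (g s)\<^sup>2\<bar> \<le> 1 + 1 / g0\<^sup>2"
        by (simp add: abs_le_iff) (smt (verit) zero_le_divide_1_iff zero_le_power2)
      have "\<bar>d\<bar> = \<bar>1 - 1 / (g s)\<^sup>2\<bar> * lam * (2 * lam * \<bar>u s * u' s\<bar>)"
        using lam by (simp add: d_def abs_mult)
      also have "\<dots> \<le> (1 + 1 / g0\<^sup>2) * lam * E s"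
        using c lam two_mult_le_energy[OF lam, of "u s" "u' s"]
        by (intro mult_mono) (auto simp: energy_def)
      finally show ?thesis .
    qed
    ultimately show "\<exists>d. (E has_real_derivative d) (at s) \<and> \<bar>d\<bar> \<le> (1 + 1 / g0\<^sup>2) * lam * E s"
      by blast
  qed (use ab t lam E_nonneg in auto)
  also have "\<dots> = (1 + 1 / g0\<^sup>2) * lam * integral {a..t} E"
    by simp
  finally show "E t \<le> E a + (1 + 1 / g0\<^sup>2) * lam * integral {a..t} E" by linarith
qed (use ab in auto)

lemma F_comparison:
  assumes "good t"
  shows "E t \<le> m * F t" "F t \<le> m * E t"
  using quadratic_form_comparison[OF lam g0, of "\<gamma> t" g1 "\<gamma>' t" "u' t" "u t"] assms
  by (auto simp: good_def energy_def F_def m_def)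

text \<open>As \<open>r\<close> is merely integrable, \<open>F\<close> is bounded in the estimate of
  its derivative by its maximum \<open>F s\<close>. Integrating from \<open>a\<close> to
  \<open>s\<close> leaves a multiple of \<open>F s\<close> with factor at most 1/2 on the right,
  which is absorbed on the left.\<close>

lemma good_growth:
  assumes ab: "0 \<le> a" "a \<le> b" "b \<le> T" and good: "\<And>t. t \<in> {a..b} \<Longrightarrow> good t"
    and small: "integral {a..b} r \<le> 1 / (2 * \<kappa>)"
  shows "F b \<le> exp (2 * \<kappa> * integral {a..b} r) * F a"
proof -
  note abT = ab(1,3)
  have u: "C1_on_with a b u u'" by (rule C1_on_with_subset[OF u_C1 abT])
  have \<gamma>: "C1_on_with a b \<gamma> \<gamma>'" "C1_on_with a b \<gamma>' \<gamma>''"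
    by (rule C1_on_with_subset[OF \<gamma>_C1 abT], rule C1_on_with_subset[OF \<gamma>'_C1 abT])
  have gpos: "g0 / 2 \<le> \<gamma> t" "\<gamma> t > 0" if "t \<in> {a..b}" for t
    using good[OF that] g0 by (auto simp: good_def)
  note cont = C1_on_with_continuous[OF u] u[unfolded C1_on_with_def, THEN conjunct2]
    C1_on_with_continuous[OF \<gamma>(1)] C1_on_with_continuous[OF \<gamma>(2)]
  have cont_inv: "continuous_on {a..b} (\<lambda>t. 1 / \<gamma> t)"
    using gpos(2) by (intro continuous_intros cont) (metis less_irrefl)
  have ac_inv: "abs_continuous_on_interval a b (\<lambda>t. 1 / \<gamma> t)"
  proof (rule abs_continuous_on_interval_comb[where M = "4 / g0\<^sup>2"])
    fix x y assume x: "x \<in> {a..b}" and y: "y \<in> {a..b}"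
    have "\<bar>1 / \<gamma> x - 1 / \<gamma> y\<bar> = \<bar>\<gamma> x - \<gamma> y\<bar> / (\<gamma> x * \<gamma> y)"
      using gpos(2)[OF x] gpos(2)[OF y] by (simp add: diff_frac_eq abs_mult abs_minus_commute)
    also have "\<dots> \<le> \<bar>\<gamma> x - \<gamma> y\<bar> / ((g0 / 2) * (g0 / 2))"
      using gpos[OF x] gpos[OF y] g0 by (intro divide_left_mono mult_mono mult_pos_pos) auto
    also have "\<dots> = 4 / g0\<^sup>2 * \<bar>\<gamma> x - \<gamma> y\<bar>" by (simp add: power2_eq_square)
    also have "\<dots> \<le> 4 / g0\<^sup>2 * (\<bar>\<gamma> x - \<gamma> y\<bar> + \<bar>\<gamma> x - \<gamma> y\<bar>)"
      by (intro mult_left_mono) auto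
    finally show "\<bar>1 / \<gamma> x - 1 / \<gamma> y\<bar> \<le> 4 / g0\<^sup>2 * (\<bar>\<gamma> x - \<gamma> y\<bar> + \<bar>\<gamma> x - \<gamma> y\<bar>)" .
  qed (rule C1_on_with_abs_continuous[OF \<gamma>(1)])+
  have const: "abs_continuous_on_interval a b (\<lambda>t. lam\<^sup>2)"
    by (rule abs_continuous_on_interval_lipschitz[where M = 0]) auto
  note ac = abs_continuous_on_interval_subset[OF u'_ac abT] C1_on_with_abs_continuous[OF u]
    C1_on_with_abs_continuous[OF \<gamma>(1)] C1_on_with_abs_continuous[OF \<gamma>(2)]
  have "abs_continuous_on_interval a b
      (\<lambda>t. \<gamma> t * (u' t * u' t) - \<gamma>' t * u t * u' t + lam\<^sup>2 * (1 / \<gamma> t) * (u t * u t))"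
    by (intro abs_continuous_on_interval_add abs_continuous_on_interval_diff
      abs_continuous_on_interval_mult ac cont cont_inv ac_inv const continuous_intros)
  then have F_ac: "abs_continuous_on_interval a b F"
    by (simp add: F_def[abs_def] power2_eq_square)
  have F_cont: "continuous_on {a..b} F"
    unfolding F_def[abs_def] using gpos(2) by (intro continuous_intros cont) (metis less_irrefl)
  have F_nonneg: "0 \<le> F t" if "t \<in> {a..b}" for t
  proof -
    have "0 \<le> m * F t" using F_comparison(1)[OF good[OF that]] E_nonneg[of t] by linarith
    then show ?thesis using m by (simp add: zero_le_mult_iff)
  qed
  obtain s where s: "s \<in> {a..b}" "\<And>t. t \<in> {a..b} \<Longrightarrow> F t \<le> F s"
    using continuous_attains_sup[OF compact_Icc _ F_cont] ab by auto
  have rint: "r integrable_on {a..b}" by (rule r_integrable_on[OF abT])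
  have "\<bar>F s - F a\<bar> \<le> integral {a..b} (\<lambda>t. \<kappa> * F s * r t)"
  proof (rule abs_continuous_oscillation[OF F_ac N])
    show "(\<lambda>t. \<kappa> * F s * r t) integrable_on {a..b}"
      using integrable_cmul[OF rint] by simp
    fix t assume t: "t \<in> {a<..<b} - N"
    then have tab: "t \<in> {a..b}" by auto
    have D: "(u has_real_derivative u' t) (at t)" "(\<gamma> has_real_derivative \<gamma>' t) (at t)"
        "(\<gamma>' has_real_derivative \<gamma>'' t) (at t)"
      by (rule C1_on_with_DERIV[OF u] C1_on_with_DERIV[OF \<gamma>(1)] C1_on_with_DERIV[OF \<gamma>(2)];
        use t in auto)+
    have u': "(u' has_real_derivative - (lam\<^sup>2 * u t / (g t)\<^sup>2)) (at t)"
      by (rule u'_deriv) (use t ab in auto)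
    \<comment> \<open>The two terms \<open>\<gamma>' * u'\<^sup>2\<close> have cancelled, which is
      the purpose of the mixed term of \<open>F\<close>. Apart from \<gamma>'', what remains is
      small when \<gamma> is close to \<open>g\<close>.\<close>
    define d where "d = u t * u' t * (2 * lam\<^sup>2 * (1 / \<gamma> t - \<gamma> t / (g t)\<^sup>2) - \<gamma>'' t)
      + lam\<^sup>2 * \<gamma>' t * (1 / (g t)\<^sup>2 - 1 / (\<gamma> t)\<^sup>2) * (u t)\<^sup>2"
    have gt: "g t > 0" using g_bounds[of t] g0 by linarith
    have "(F has_real_derivative d) (at t)"
      unfolding F_def[abs_def] d_def using gpos(2)[OF tab] gt
      by - ((rule derivative_eq_intros D u' refl | simp)+, simp add: field_simps power2_eq_square)
    moreover have "\<bar>d\<bar> \<le> \<kappa> * F s * r t"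
    proof -
      have "\<bar>d\<bar> \<le> (1 + 6 * g1 / g0 ^ 3 + 12 * g1 / g0 ^ 4) * r t * E t"
        unfolding d_def r_def energy_def
        using good[OF tab] g_bounds[of t] lam g0
        by (intro quadratic_form_derivative_bound) (auto simp: good_def)
      also have "\<dots> \<le> (1 + 6 * g1 / g0 ^ 3 + 12 * g1 / g0 ^ 4) * r t * (m * F s)"
      proof (intro mult_left_mono)
        show "E t \<le> m * F s"
          using F_comparison(1)[OF good[OF tab]] mult_left_mono[OF s(2)[OF tab], of m] m by linarith
      qed (use g0 g1 r_nonneg in auto)
      finally show ?thesis by (simp add: \<kappa>_def mult_ac)
    qed
    ultimately show "\<exists>d. (F has_real_derivative d) (at t) \<and> \<bar>d\<bar> \<le> \<kappa> * F s * r t" by blast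
  next
    show "0 \<le> \<kappa> * F s * r t" for t
      using \<kappa> F_nonneg[OF s(1)] r_nonneg[of t] by auto
  qed (use ab s in auto)
  also have "\<dots> = \<kappa> * F s * integral {a..b} r" by simp
  finally have le: "F s * (1 - \<kappa> * integral {a..b} r) \<le> F a"
    by (simp add: algebra_simps)
  have x: "0 \<le> \<kappa> * integral {a..b} r" "\<kappa> * integral {a..b} r \<le> 1 / 2"
  proof -
    show "0 \<le> \<kappa> * integral {a..b} r"
      using \<kappa> r_nonneg by (intro mult_nonneg_nonneg integral_nonneg rint) auto
    show "\<kappa> * integral {a..b} r \<le> 1 / 2"
      using small \<kappa> by (simp add: field_simps)
  qed
  have "F b \<le> F s * 1" using s(2)[of b] ab by auto
  also have "\<dots> \<le> F s * ((1 - \<kappa> * integral {a..b} r) * exp (2 * (\<kappa> * integral {a..b} r)))"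
    using one_le_exp_2x[OF x] F_nonneg[OF s(1)] by (intro mult_left_mono)
  also have "\<dots> = (F s * (1 - \<kappa> * integral {a..b} r)) * exp (2 * (\<kappa> * integral {a..b} r))"
    by simp
  also have "\<dots> \<le> F a * exp (2 * (\<kappa> * integral {a..b} r))"
    by (intro mult_right_mono le) auto
  finally show ?thesis by (simp add: mult_ac)
qed

section \<open>Intervals on which the integral of \<open>r\<close> is small\<close>

text \<open>The window is the range of \<open>g\<close> enlarged by \<open>g0 / 4\<close> on both
  sides. If \<gamma> avoided it, \<open>r\<close> would be at least \<open>lam * (g0 / 4)\<close>
  throughout.\<close>

lemma near_point:
  assumes "0 \<le> a" "a < b" "b \<le> T" and small: "integral {a..b} r < lam * (g0 / 4) * (b - a)"
  shows "\<exists>x. x \<in> {a..b} \<and> 3 / 4 * g0 \<le> \<gamma> x \<and> \<gamma> x \<le> g1 + g0 / 4"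
proof (rule ccontr)
  assume "\<not> ?thesis"
  then have far: "\<gamma> x < 3 / 4 * g0 \<or> g1 + g0 / 4 < \<gamma> x" if "x \<in> {a..b}" for x
    using that by (meson not_le)
  have "lam * (g0 / 4) \<le> r x" if "x \<in> {a..b}" for x
  proof -
    have "g0 / 4 \<le> \<bar>\<gamma> x - g x\<bar>"
      using far[OF that] g_bounds[of x] by linarith
    then have "lam * (g0 / 4) \<le> lam * \<bar>\<gamma> x - g x\<bar>"
      using lam by (intro mult_left_mono) auto
    then show ?thesis using lam by (simp add: r_def add_increasing)
  qed
  then have "integral {a..b} (\<lambda>x. lam * (g0 / 4)) \<le> integral {a..b} r"
    using assms by (intro integral_le r_integrable_on) auto
  then show False using small assms(2) by (simp add: mult_ac)
qed

lemma r_integral_mono: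
  assumes "0 \<le> a" "a \<le> a'" "b' \<le> b" "b \<le> T"
  shows "integral {a'..b'} r \<le> integral {a..b} r"
  by (rule integral_subset_le) (use assms r_nonneg in \<open>auto intro!: r_integrable_on\<close>)

text \<open>Points of the window in the two outer thirds give, by the mean value theorem, one place
  where \<bar>\<gamma>'\<bar> \<le> lam / 2. Smallness of the integral of \<bar>\<gamma>''\<bar>
  extends this to \<bar>\<gamma>'\<bar> \<le> lam everywhere, and then a window point close to
  \<open>t\<close> controls \<gamma> at \<open>t\<close>.\<close>

lemma good_interval:
  assumes a: "0 \<le> a" and b: "b = a + 6 * g1 / lam" "b \<le> T"
    and small: "integral {a..b} r < \<epsilon>" and t: "t \<in> {a..b}"
  shows "good t"
proof -
  \<comment> \<open>A third of the interval. The window is shorter than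
    \<open>g1 = l * lam / 2\<close>, and points in the outer thirds are at least \<open>l\<close>
    apart, so the mean slope is at most \<open>lam / 2\<close>.\<close>
  define l where "l = 2 * g1 / lam"
  have l: "l > 0" "b = a + 3 * l" using g1 lam b by (auto simp: l_def)
  have ab: "a < b" using l by simp
  have sub: "integral {a'..b'} r < \<epsilon>" if "a \<le> a'" "b' \<le> b" for a' b'
    using r_integral_mono[OF a that b(2)] small by linarith
  have near: "\<exists>x. x \<in> {a'..b'} \<and> 3 / 4 * g0 \<le> \<gamma> x \<and> \<gamma> x \<le> g1 + g0 / 4"
    if "a \<le> a'" "b' \<le> b" "g0 / 8 \<le> lam * (b' - a')" for a' b'
  proof (rule near_point[of a' b'])
    have "0 < lam * (b' - a')" using that(3) g0 by linarith
    then show "a' < b'" using lam by (simp add: zero_less_mult_iff)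
    have "integral {a'..b'} r < g0\<^sup>2 / 32" using sub[OF that(1,2)] \<epsilon>(3) by linarith
    also have "\<dots> = (g0 / 4) * (g0 / 8)" by (simp add: power2_eq_square)
    also have "\<dots> \<le> (g0 / 4) * (lam * (b' - a'))" using that(3) g0 by (intro mult_left_mono) auto
    finally show "integral {a'..b'} r < lam * (g0 / 4) * (b' - a')" by (simp add: mult_ac)
  qed (use that a b in auto)
  have laml: "lam * l = 2 * g1" using lam by (simp add: l_def)
  have l8: "g0 / 8 \<le> lam * l" using g1 g0 unfolding laml by linarith
  obtain x where x: "x \<in> {a..a + l}" "3 / 4 * g0 \<le> \<gamma> x" "\<gamma> x \<le> g1 + g0 / 4"
    using near[of a "a + l"] l l8 by auto
  obtain y where y: "y \<in> {b - l..b}" "3 / 4 * g0 \<le> \<gamma> y" "\<gamma> y \<le> g1 + g0 / 4"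
    using near[of "b - l" b] l l8 by auto
  have xy: "x \<in> {0..T}" "y \<in> {0..T}" "x < y" "l \<le> y - x" using x y l a b by auto
  obtain z where z: "x < z" "z < y" "\<gamma> y - \<gamma> x = (y - x) * \<gamma>' z"
    using C1_on_with_mean_value[OF \<gamma>_C1 xy(1-3)] .
  have \<gamma>'z: "\<bar>\<gamma>' z\<bar> \<le> lam / 2"
  proof -
    have "l * \<bar>\<gamma>' z\<bar> \<le> (y - x) * \<bar>\<gamma>' z\<bar>" using xy by (intro mult_right_mono) auto
    also have "\<dots> = \<bar>\<gamma> y - \<gamma> x\<bar>" using z(3) xy by (simp add: abs_mult)
    also have "\<dots> \<le> g1" using x y g0 by auto
    also have "g1 = l * (lam / 2)" using laml by (simp add: mult.commute)
    finally show ?thesis using l by simp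
  qed
  have \<gamma>'_le: "\<bar>\<gamma>' s\<bar> \<le> lam" if s: "s \<in> {a..b}" for s
  proof -
    have C1: "C1_on_with a b \<gamma>' \<gamma>''" by (rule C1_on_with_subset[OF \<gamma>'_C1 a b(2)])
    have "\<bar>\<gamma>' s - \<gamma>' z\<bar> \<le> integral {a..b} (\<lambda>t. lam * r t)"
    proof (rule abs_continuous_oscillation[OF C1_on_with_abs_continuous[OF C1] negligible_empty])
      show "(\<lambda>t. lam * r t) integrable_on {a..b}"
        using integrable_cmul[OF r_integrable_on[OF a b(2)], of lam] by simp
      show "\<exists>d. (\<gamma>' has_real_derivative d) (at t) \<and> \<bar>d\<bar> \<le> lam * r t" if "t \<in> {a<..<b} - {}" for t
        using C1_on_with_DERIV[OF C1, of t] that lam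
        by (intro exI[of _ "\<gamma>'' t"]) (auto simp: r_def distrib_left)
    qed (use s z x y r_nonneg lam in auto)
    also have "\<dots> = lam * integral {a..b} r" by simp
    also have "\<dots> \<le> lam * (1 / 2)" using small \<epsilon>(2) lam by (intro mult_left_mono) auto
    finally show ?thesis using \<gamma>'z by linarith
  qed
  \<comment> \<open>The least length for which \<open>near\<close> applies; with slope at most
    \<open>lam\<close>, \<gamma> changes by at most \<open>g0 / 8\<close> over it.\<close>
  define w where "w = g0 / (8 * lam)"
  have w: "w > 0" "lam * w = g0 / 8" using lam g0 by (auto simp: w_def)
  have "lam * w \<le> lam * l" using w l8 by simp
  then have wl: "w \<le> l" using lam by simp
  \<comment> \<open>A subinterval of length \<open>w\<close> around \<open>t\<close>: it starts at
    \<open>t\<close>, or ends at \<open>b\<close> when \<open>t\<close> is too close to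
    \<open>b\<close>.\<close>
  obtain p where p: "a \<le> p" "p + w \<le> b" "t \<in> {p..p + w}"
  proof (cases "t + w \<le> b")
    case True then show ?thesis using that[of t] t w by auto
  next
    case False then show ?thesis using that[of "b - w"] t w wl l by auto
  qed
  obtain s where s: "s \<in> {p..p + w}" "3 / 4 * g0 \<le> \<gamma> s" "\<gamma> s \<le> g1 + g0 / 4"
    using near[of p "p + w"] p w by auto
  have "\<bar>\<gamma> t - \<gamma> s\<bar> \<le> lam * \<bar>t - s\<bar>"
    by (rule C1_on_with_lipschitz[OF C1_on_with_subset[OF \<gamma>_C1 a b(2)] \<gamma>'_le]) (use t s p in auto)
  also have "\<dots> \<le> lam * w" using s p lam by (intro mult_left_mono) auto
  finally have "\<bar>\<gamma> t - \<gamma> s\<bar> \<le> g0 / 8" using w by simp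
  then have "g0 / 2 \<le> \<gamma> t" "\<gamma> t \<le> 2 * g1"
    using s(2,3) g1 g0 by linarith+
  then show ?thesis using \<gamma>'_le[OF t] by (simp add: good_def)
qed

text \<open>
  The weight \<open>m\<close> makes \<open>W\<close> lie between \<open>E / m\<close> and \<open>m * E\<close> at every time, so that \<open>W\<close> is at most
  multiplied by a factor at each step and no transition between \<open>F\<close> and \<open>E\<close> has to be counted.
\<close>

definition W where "W t = (if good t then F t else m * E t)"

text \<open>The exponent of the crude bound over a step of length \<open>6 * g1 / lam\<close>, where
  \<open>lam\<close> cancels.\<close>

definition K where "K = (1 + 1 / g0\<^sup>2) * (6 * g1)"

text \<open>Cost per unit of the integral of \<open>r\<close>: a step with integral below \<epsilon>
  costs at most \<open>2 * \<kappa>\<close> per unit, and any other step has at least \<epsilon> to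
  which its loss \<open>2 * ln m + K\<close> is charged.\<close>

definition A where "A = 2 * \<kappa> + (2 * ln m + K) / \<epsilon>"

lemma W_comparison: "W t \<le> m * E t" "E t \<le> m * W t" "0 \<le> W t"
proof -
  have m2: "E t \<le> m * E t" "m * E t \<le> m * (m * E t)"
    using m E_nonneg[of t] mult_right_mono[of 1 m "E t"] mult_right_mono[of 1 m "m * E t"] by auto
  show "W t \<le> m * E t" using F_comparison by (simp add: W_def)
  show 1: "E t \<le> m * W t" using F_comparison m2 by (simp add: W_def)
  show "0 \<le> W t"
    using 1 m E_nonneg[of t] by (smt (verit) mult_pos_neg)
qed

lemma K: "0 \<le> K"
  using g1 by (simp add: K_def)

lemma A: "2 * \<kappa> \<le> A" "2 * ln m + K \<le> A * \<epsilon>" "0 \<le> A"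
proof -
  have "0 \<le> (2 * ln m + K) / \<epsilon>" using K m \<epsilon> by simp
  then show "2 * \<kappa> \<le> A" "0 \<le> A" using \<kappa> by (auto simp: A_def)
  show "2 * ln m + K \<le> A * \<epsilon>"
    using \<epsilon>(1) \<kappa> by (simp add: A_def distrib_right[of "2 * \<kappa>"])
qed

section \<open>Growth over one step and over many steps\<close>

lemma crude_growth_K:
  assumes "0 \<le> a" "a \<le> b" "b \<le> T" "b - a \<le> 6 * g1 / lam"
  shows "E b \<le> exp K * E a"
proof -
  have "(1 + 1 / g0\<^sup>2) * (lam * (b - a)) \<le> (1 + 1 / g0\<^sup>2) * (6 * g1)"
    using assms(4) lam by (intro mult_left_mono) (auto simp: field_simps)
  then have "exp ((1 + 1 / g0\<^sup>2) * lam * (b - a)) \<le> exp K"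
    by (simp add: K_def mult.assoc)
  then have "E a * exp ((1 + 1 / g0\<^sup>2) * lam * (b - a)) \<le> E a * exp K"
    using E_nonneg by (intro mult_left_mono)
  then show ?thesis using crude_growth[OF assms(1-3)] by (simp add: mult.commute)
qed

lemma W_step:
  assumes a: "0 \<le> a" and b: "b = a + 6 * g1 / lam" "b \<le> T"
  shows "W b \<le> exp (A * integral {a..b} r) * W a"
proof -
  have ab: "a \<le> b" using b g1 lam by simp
  have r0: "0 \<le> integral {a..b} r"
    using r_nonneg by (intro integral_nonneg r_integrable_on a b) auto
  show ?thesis
  proof (cases "integral {a..b} r < \<epsilon>")
    case True
    note good = good_interval[OF a b True]
    have "F b \<le> exp (2 * \<kappa> * integral {a..b} r) * F a"
      by (rule good_growth[OF a ab b(2) good]) (use True \<epsilon>(4) in auto)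
    then have "W b \<le> exp (2 * \<kappa> * integral {a..b} r) * W a"
      \<comment> \<open>Both end points are good, so \<open>W\<close> equals \<open>F\<close> at
        each and no comparison factor appears.\<close>
      using good[of a] good[of b] ab by (simp add: W_def)
    also have "\<dots> \<le> exp (A * integral {a..b} r) * W a"
      using A(1) r0 W_comparison(3) by (intro mult_right_mono) (auto intro: mult_right_mono)
    finally show ?thesis .
  next
    case False
    \<comment> \<open>The detour through the energy costs one factor \<open>m\<close> at each end of
      the step.\<close>
    have "W b \<le> m * E b" by (rule W_comparison)
    also have "\<dots> \<le> m * (exp K * (m * W a))"
    proof (intro mult_left_mono)
      have "E b \<le> exp K * E a" by (rule crude_growth_K) (use a ab b in auto)
      also have "\<dots> \<le> exp K * (m * W a)" by (intro mult_left_mono W_comparison) auto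
      finally show "E b \<le> exp K * (m * W a)" .
    qed (use m in auto)
    also have "\<dots> = exp (2 * ln m + K) * W a"
      using m by (simp add: exp_add exp_double power2_eq_square)
    also have "\<dots> \<le> exp (A * integral {a..b} r) * W a"
    proof (intro mult_right_mono W_comparison)
      have "A * \<epsilon> \<le> A * integral {a..b} r" using False A(3) by (intro mult_left_mono) auto
      then show "exp (2 * ln m + K) \<le> exp (A * integral {a..b} r)" using A(2) by simp
    qed
    finally show ?thesis .
  qed
qed

lemma W_iterate:
  assumes "real n * (6 * g1 / lam) \<le> T"
  shows "W (real n * (6 * g1 / lam)) \<le> exp (A * integral {0..real n * (6 * g1 / lam)} r) * W 0"
  using assms
proof (induction n)
  case 0
  then show ?case by simp
next
  case (Suc n)
  define h where "h = 6 * g1 / lam"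
  have h: "h > 0" using g1 lam by (simp add: h_def)
  have S: "real (Suc n) * h = real n * h + h" by (simp add: algebra_simps)
  have T: "real n * h + h \<le> T" using Suc.prems unfolding h_def[symmetric] S .
  have IH: "W (real n * h) \<le> exp (A * integral {0..real n * h} r) * W 0"
    using Suc.IH T h unfolding h_def[symmetric] by simp
  have "W (real n * h + h) \<le> exp (A * integral {real n * h..real n * h + h} r) * W (real n * h)"
  proof (rule W_step)
    show "0 \<le> real n * h" using h by simp
  qed (use T in \<open>auto simp: h_def\<close>)
  also have "\<dots> \<le> exp (A * integral {real n * h..real n * h + h} r) * (exp (A * integral {0..real n * h} r) * W 0)"
    by (intro mult_left_mono IH) auto
  also have "\<dots> = exp (A * (integral {0..real n * h} r + integral {real n * h..real n * h + h} r)) * W 0"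
    by (simp add: distrib_left exp_add)
  also have "integral {0..real n * h} r + integral {real n * h..real n * h + h} r = integral {0..real n * h + h} r"
    by (rule Henstock_Kurzweil_Integration.integral_combine) (use h T in \<open>auto intro: r_integrable_on\<close>)
  finally show ?case unfolding h_def[symmetric] S .
qed

text \<open>Whole steps are covered by the iteration, the remainder before \<open>t\<close> by one
  crude step. The comparison of \<open>W\<close> with the energy is paid only twice, at time 0 and
  after the last whole step.\<close>

lemma energy_bound:
  assumes t: "t \<in> {0..T}"
  shows "E t \<le> exp (K + 2 * ln m + A * integral {0..T} r) * E 0"
proof -
  define h where "h = 6 * g1 / lam"
  have h: "h > 0" using g1 lam by (simp add: h_def)
  define n where "n = nat \<lfloor>t / h\<rfloor>"
  have "0 \<le> t / h" using t h by simp
  then have n: "real n \<le> t / h" "t / h < real n + 1"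
    unfolding n_def by linarith+
  have nh: "real n * h \<le> t" "t - real n * h \<le> h"
    using n h by (auto simp: field_simps)
  have "E t \<le> exp K * E (real n * h)"
  proof (rule crude_growth_K)
    show "0 \<le> real n * h" using h by simp
  qed (use nh t in \<open>auto simp: h_def\<close>)
  also have "\<dots> \<le> exp K * (m * W (real n * h))"
    by (intro mult_left_mono W_comparison) auto
  also have "\<dots> \<le> exp K * (m * (exp (A * integral {0..T} r) * (m * E 0)))"
  proof (intro mult_left_mono)
    have "W (real n * h) \<le> exp (A * integral {0..real n * h} r) * W 0"
      unfolding h_def by (rule W_iterate) (use nh t in \<open>auto simp: h_def\<close>)
    also have "\<dots> \<le> exp (A * integral {0..T} r) * (m * E 0)"
    proof (intro mult_mono W_comparison)
      have "A * integral {0..real n * h} r \<le> A * integral {0..T} r"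
        using A(3) nh t by (intro mult_left_mono r_integral_mono) auto
      then show "exp (A * integral {0..real n * h} r) \<le> exp (A * integral {0..T} r)" by simp
    qed auto
    finally show "W (real n * h) \<le> exp (A * integral {0..T} r) * (m * E 0)" .
  qed (use m in auto)
  also have "\<dots> = exp (K + 2 * ln m + A * integral {0..T} r) * E 0"
    using m by (simp add: exp_add exp_double power2_eq_square mult_ac)
  finally show ?thesis .
qed

end

subsection \<open>Passing to the infimum\<close>

lemma AE_lebesgue_on_negligible:
  assumes "AE t in lebesgue_on S. P t" "S \<in> sets lebesgue"
  obtains N where "negligible N" "\<And>t. t \<in> S - N \<Longrightarrow> P t"
proof -
  have "AE t in lebesgue. t \<in> S \<longrightarrow> P t"
    using assms by (simp add: AE_restrict_space_iff)
  then obtain N where "{t \<in> space lebesgue. \<not> (t \<in> S \<longrightarrow> P t)} \<subseteq> N" "N \<in> null_sets lebesgue"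
    unfolding eventually_ae_filter by blast
  then show thesis
    by (intro that[of N]) (auto simp: negligible_iff_null_sets)
qed

lemma absolutely_integrable_bounded_Ioo:
  fixes f :: "real \<Rightarrow> real"
  assumes "f \<in> borel_measurable (lebesgue_on {a<..<b})" "\<And>t. t \<in> {a<..<b} \<Longrightarrow> \<bar>f t\<bar> \<le> B"
  shows "f absolutely_integrable_on {a<..<b}"
proof (rule measurable_bounded_by_integrable_imp_absolutely_integrable[OF assms(1)])
  show "(\<lambda>t. B) integrable_on {a<..<b}"
    by (simp add: integrable_on_open_interval_real integrable_continuous_interval)
qed (use assms(2) in auto)

text \<open>Bridges two settings: Lebesgue integrals over the open interval with
  \<open>h = 1 / c\<close>, and the gauge integral over the closed interval with its truncation
  \<open>g\<close>, equal to \<open>h\<close> almost everywhere.\<close>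

lemma M2_functional_integral:
  assumes C2: "C2_on_with 0 T \<gamma> \<gamma>' \<gamma>''" and lam: "lam > 0"
    and g: "g \<in> borel_measurable (lebesgue_on {0<..<T})" "\<And>t. \<bar>g t\<bar> \<le> B"
    and N: "negligible N" "\<And>t. t \<in> {0<..<T} - N \<Longrightarrow> h t = g t"
  shows "(\<lambda>t. \<bar>\<gamma>'' t\<bar> / lam + lam * \<bar>\<gamma> t - g t\<bar>) integrable_on {0..T}"
    and "1 / lam * (LINT x:{0<..<T}|lebesgue. \<bar>\<gamma>'' x\<bar>) + lam * (LINT x:{0<..<T}|lebesgue. \<bar>\<gamma> x - h x\<bar>)
      = integral {0..T} (\<lambda>t. \<bar>\<gamma>'' t\<bar> / lam + lam * \<bar>\<gamma> t - g t\<bar>)"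
proof -
  have C1: "C1_on_with 0 T \<gamma> \<gamma>'" "C1_on_with 0 T \<gamma>' \<gamma>''"
    using C2 by (auto simp: C2_on_with_def)
  have "continuous_on {0..T} (\<lambda>t. \<bar>\<gamma>'' t\<bar>)"
    using C1(2) by (auto simp: C1_on_with_def intro: continuous_intros)
  then have "(\<lambda>t. \<bar>\<gamma>'' t\<bar>) absolutely_integrable_on {0..T}"
    by (rule absolutely_integrable_continuous_real)
  then have 1: "(\<lambda>t. \<bar>\<gamma>'' t\<bar>) absolutely_integrable_on {0<..<T}"
    by (rule set_integrable_subset) auto
  note cont = C1_on_with_continuous[OF C1(1)]
  have "\<gamma> absolutely_integrable_on {0..T}"
    using cont by (rule absolutely_integrable_continuous_real)
  then have "\<gamma> absolutely_integrable_on {0<..<T}"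
    by (rule set_integrable_subset) auto
  moreover have "g absolutely_integrable_on {0<..<T}"
    by (rule absolutely_integrable_bounded_Ioo[OF g])
  ultimately have "(\<lambda>t. norm (\<gamma> t - g t)) absolutely_integrable_on {0<..<T}"
    by (intro absolutely_integrable_norm[unfolded o_def] set_integral_diff)
  then have 2: "(\<lambda>t. \<bar>\<gamma> t - g t\<bar>) absolutely_integrable_on {0<..<T}"
    by simp
  have 3: "(\<lambda>t. \<bar>\<gamma> t - h t\<bar>) absolutely_integrable_on {0<..<T}"
    by (rule absolutely_integrable_spike[OF 2 N(1)]) (use N(2) in auto)
  have eq: "integral {0<..<T} (\<lambda>t. \<bar>\<gamma> t - h t\<bar>) = integral {0<..<T} (\<lambda>t. \<bar>\<gamma> t - g t\<bar>)"
    by (rule integral_spike[OF N(1)]) (use N(2) in auto)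
  note I1 = set_lebesgue_integral_eq_integral[OF 1] and I2 = set_lebesgue_integral_eq_integral[OF 2]
    and I3 = set_lebesgue_integral_eq_integral[OF 3]
  have i1: "(\<lambda>t. \<bar>\<gamma>'' t\<bar> / lam) integrable_on {0<..<T}"
    using integrable_cmul[OF I1(1), of "1 / lam"] by simp
  have i2: "(\<lambda>t. lam * \<bar>\<gamma> t - g t\<bar>) integrable_on {0<..<T}"
    using integrable_cmul[OF I2(1), of lam] by simp
  have "(\<lambda>t. \<bar>\<gamma>'' t\<bar> / lam + lam * \<bar>\<gamma> t - g t\<bar>) integrable_on {0<..<T}"
    by (rule integrable_add[OF i1 i2])
  then show "(\<lambda>t. \<bar>\<gamma>'' t\<bar> / lam + lam * \<bar>\<gamma> t - g t\<bar>) integrable_on {0..T}"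
    by (simp add: integrable_on_open_interval_real)
  have "integral {0..T} (\<lambda>t. \<bar>\<gamma>'' t\<bar> / lam + lam * \<bar>\<gamma> t - g t\<bar>)
      = integral {0<..<T} (\<lambda>t. \<bar>\<gamma>'' t\<bar> / lam + lam * \<bar>\<gamma> t - g t\<bar>)"
    by (simp add: integral_open_interval_real)
  also have "\<dots> = integral {0<..<T} (\<lambda>t. \<bar>\<gamma>'' t\<bar> / lam) + integral {0<..<T} (\<lambda>t. lam * \<bar>\<gamma> t - g t\<bar>)"
    by (rule integral_add[OF i1 i2])
  also have "\<dots> = 1 / lam * integral {0<..<T} (\<lambda>t. \<bar>\<gamma>'' t\<bar>) + lam * integral {0<..<T} (\<lambda>t. \<bar>\<gamma> t - g t\<bar>)"
    by simp
  finally show "1 / lam * (LINT x:{0<..<T}|lebesgue. \<bar>\<gamma>'' x\<bar>) + lam * (LINT x:{0<..<T}|lebesgue. \<bar>\<gamma> x - h x\<bar>)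
      = integral {0..T} (\<lambda>t. \<bar>\<gamma>'' t\<bar> / lam + lam * \<bar>\<gamma> t - g t\<bar>)"
    using I1(2) I3(2) eq by simp
qed

theorem corollary6p2:
  fixes T \<nu>\<^sub>1 \<nu>\<^sub>2 :: real and c :: "real \<Rightarrow> real"
  assumes "T > 0" and "\<nu>\<^sub>1 > 0" and "\<nu>\<^sub>2 > 0" and "\<nu>\<^sub>1 \<le> \<nu>\<^sub>2"
    and "c \<in> borel_measurable (lebesgue_on {0<..<T})"
    and "AE t in lebesgue_on {0<..<T}. \<nu>\<^sub>1 \<le> c t \<and> c t \<le> \<nu>\<^sub>2"
  shows "\<exists>C>0. \<forall>lam>0. growth c lam T \<le> C * (1 + M2 T (\<lambda>t. 1 / c t) lam)"
proof -
  define g0 where "g0 = 1 / \<nu>\<^sub>2"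
  define g1 where "g1 = 1 / \<nu>\<^sub>1"
  \<comment> \<open>Truncation makes the bounds hold at every point while changing
    \<open>1 / c\<close> inside the interval only on a null set.\<close>
  define g where "g = (\<lambda>t. max g0 (min g1 (1 / c t)))"
  have g0: "0 < g0" "g0 \<le> g1"
    using assms(2-4) by (auto simp: g0_def g1_def frac_le)
  have g_bounds: "g0 \<le> g t" "g t \<le> g1" for t
    using g0 by (auto simp: g_def)
  have g_meas: "g \<in> borel_measurable (lebesgue_on {0<..<T})"
    unfolding g_def using assms(5) by measurable
  obtain N where N: "negligible N" "\<And>t. t \<in> {0<..<T} - N \<Longrightarrow> \<nu>\<^sub>1 \<le> c t \<and> c t \<le> \<nu>\<^sub>2"
    using AE_lebesgue_on_negligible[OF assms(6)] by auto
  have g_eq: "g t = 1 / c t" "c t > 0" if "t \<in> {0<..<T} - N" for t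
  proof -
    show c: "c t > 0" using N(2)[OF that] assms(2) by linarith
    have "g0 \<le> 1 / c t" "1 / c t \<le> g1"
      using N(2)[OF that] c assms(2,3) by (auto simp: g0_def g1_def intro!: frac_le)
    then show "g t = 1 / c t" by (simp add: g_def)
  qed
  define C where "C = max 1 (max (wave_comparison.K g0 g1 + 2 * ln (wave_comparison.m g0 g1))
    (wave_comparison.A g0 g1))"
  have "growth c lam T \<le> C * (1 + M2 T (\<lambda>t. 1 / c t) lam)" if lam: "lam > 0" for lam
  proof -
    define S where "S = {energy lam u u' t | u u' t.
      wave_solution c lam T u u' \<and> energy lam u u' 0 \<le> 1 \<and> t \<in> {0..T}}"
    define J where "J = (\<lambda>\<gamma> \<gamma>''. 1 / lam * (LINT x:{0<..<T}|lebesgue. \<bar>\<gamma>'' x\<bar>)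
      + lam * (LINT x:{0<..<T}|lebesgue. \<bar>\<gamma> x - 1 / c x\<bar>))"
    have zero_sol: "wave_solution c lam T (\<lambda>_. 0) (\<lambda>_. 0)"
    proof -
      have "abs_continuous_on_interval 0 T (\<lambda>_. 0)"
        by (rule abs_continuous_on_interval_lipschitz[where M = 0]) auto
      moreover have "C1_on_with 0 T (\<lambda>_. 0) (\<lambda>_. 0)"
        by (simp add: C1_on_with_def)
      moreover have "\<exists>u''. ((\<lambda>_. 0) has_real_derivative u'') (at t) \<and> u'' + lam\<^sup>2 * (c t)\<^sup>2 * 0 = 0" for t
        by (intro exI[of _ 0]) auto
      ultimately show ?thesis unfolding wave_solution_def by (intro conjI AE_I2)
    qed
    \<comment> \<open>The zero solution makes the set of energies nonempty and its supremum
      nonnegative.\<close>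
    have S0: "0 \<in> S"
    proof -
      have "0 = energy lam (\<lambda>_. 0) (\<lambda>_. 0) 0" by (simp add: energy_def)
      then show ?thesis
        using zero_sol assms(1) unfolding S_def by fastforce
    qed
    have bound: "growth c lam T \<le> C * (1 + J \<gamma> \<gamma>'')" if C2: "C2_on_with 0 T \<gamma> \<gamma>' \<gamma>''" for \<gamma> \<gamma>' \<gamma>''
    proof -
      have gB: "\<bar>g t\<bar> \<le> g1" for t using g_bounds[of t] g0 by auto
      note J_eq = M2_functional_integral[OF C2 lam g_meas gB N(1), of "\<lambda>t. 1 / c t"]
      have J: "J \<gamma> \<gamma>'' = integral {0..T} (\<lambda>t. \<bar>\<gamma>'' t\<bar> / lam + lam * \<bar>\<gamma> t - g t\<bar>)"
        unfolding J_def by (rule J_eq(2)) (use g_eq in auto)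
      have integrable: "(\<lambda>t. \<bar>\<gamma>'' t\<bar> / lam + lam * \<bar>\<gamma> t - g t\<bar>) integrable_on {0..T}"
        by (rule J_eq(1)) (use g_eq in auto)
      have J0: "0 \<le> J \<gamma> \<gamma>''"
        unfolding J using lam by (intro integral_nonneg integrable) auto
      have le: "e \<le> exp (C * (1 + J \<gamma> \<gamma>''))" if "e \<in> S" for e
      proof -
        obtain u u' t where u: "e = energy lam u u' t" "wave_solution c lam T u u'"
            "energy lam u u' 0 \<le> 1" "t \<in> {0..T}"
          using \<open>e \<in> S\<close> unfolding S_def by blast
        have AE: "AE t in lebesgue_on {0<..<T}.
            \<exists>u''. (u' has_real_derivative u'') (at t) \<and> u'' + lam\<^sup>2 * (c t)\<^sup>2 * u t = 0"
          using u(2) by (simp add: wave_solution_def)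
        obtain N' where N': "negligible N'" "\<And>t. t \<in> {0<..<T} - N' \<Longrightarrow>
            \<exists>u''. (u' has_real_derivative u'') (at t) \<and> u'' + lam\<^sup>2 * (c t)\<^sup>2 * u t = 0"
          using AE_lebesgue_on_negligible[OF AE] by auto
        \<comment> \<open>Off \<open>N\<close> the truncation equals \<open>1 / c\<close>; off
          \<open>N'\<close> the equation holds.\<close>
        interpret wave_comparison T lam g0 g1 u u' \<gamma> \<gamma>' \<gamma>'' g "N \<union> N'"
        proof
          fix t assume t: "t \<in> {0<..<T} - (N \<union> N')"
          then obtain d where d: "(u' has_real_derivative d) (at t)" "d + lam\<^sup>2 * (c t)\<^sup>2 * u t = 0"
            using N'(2)[of t] by auto
          have "d = - (lam\<^sup>2 * u t / (g t)\<^sup>2)"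
            using d(2) g_eq[of t] t by (simp add: power_divide mult_ac)
          with d(1) show "(u' has_real_derivative - (lam\<^sup>2 * u t / (g t)\<^sup>2)) (at t)" by simp
        qed (use lam g0 g_bounds N N' u C2 integrable in \<open>auto simp: wave_solution_def C2_on_with_def\<close>)
        have "e \<le> exp (K + 2 * ln m + A * J \<gamma> \<gamma>'') * energy lam u u' 0"
          using energy_bound[OF u(4)] unfolding u(1) J
          by (simp only: r_def[abs_def])
        also have "\<dots> \<le> exp (K + 2 * ln m + A * J \<gamma> \<gamma>'') * 1"
          by (intro mult_left_mono u) auto
        also have "K + 2 * ln m + A * J \<gamma> \<gamma>'' \<le> C + C * J \<gamma> \<gamma>''"
          by (intro add_mono mult_right_mono J0) (auto simp: C_def)
        finally show ?thesis by (simp add: distrib_left)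
      qed
      have nonneg: "0 \<le> C * (1 + J \<gamma> \<gamma>'')"
        using J0 by (intro mult_nonneg_nonneg) (auto simp: C_def)
      have "Sup S \<le> exp (C * (1 + J \<gamma> \<gamma>''))"
        using S0 le by (intro cSup_least) auto
      moreover have "0 \<le> Sup S"
        using S0 le by (intro cSup_upper bdd_aboveI) auto
      ultimately have "ln (Sup S) \<le> C * (1 + J \<gamma> \<gamma>'')"
        \<comment> \<open>The value 0 of the supremum is not excluded beforehand; in that case
          \<open>ln 0 = 0\<close> and nonnegativity of the right-hand side suffices.\<close>
        using nonneg by (cases "Sup S = 0") (auto simp: ln_ge_iff ln_le_cancel_iff[symmetric] simp del: ln_le_cancel_iff)
      then show ?thesis by (simp add: growth_def S_def)
    qed
    have C0: "C > 0" by (simp add: C_def)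
    \<comment> \<open>Solved for the functional, the bound becomes one lower bound valid for all
      competitors, hence for the infimum; the zero competitor shows that the set is
      nonempty.\<close>
    have "growth c lam T / C - 1 \<le> M2 T (\<lambda>t. 1 / c t) lam"
      unfolding M2_def
    proof (rule cInf_greatest)
      have "C2_on_with 0 T (\<lambda>_. 0) (\<lambda>_. 0) (\<lambda>_. 0)"
        by (simp add: C2_on_with_def C1_on_with_def)
      then show "{1 / lam * (LINT x:{0<..<T}|lebesgue. \<bar>\<gamma>'' x\<bar>) + lam * (LINT x:{0<..<T}|lebesgue. \<bar>\<gamma> x - 1 / c x\<bar>)
          | \<gamma> \<gamma>' \<gamma>''. C2_on_with 0 T \<gamma> \<gamma>' \<gamma>''} \<noteq> {}"
        by blast
      fix x assume "x \<in> {1 / lam * (LINT x:{0<..<T}|lebesgue. \<bar>\<gamma>'' x\<bar>) + lam * (LINT x:{0<..<T}|lebesgue. \<bar>\<gamma> x - 1 / c x\<bar>)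
          | \<gamma> \<gamma>' \<gamma>''. C2_on_with 0 T \<gamma> \<gamma>' \<gamma>''}"
      then obtain \<gamma> \<gamma>' \<gamma>'' where "C2_on_with 0 T \<gamma> \<gamma>' \<gamma>''" "x = J \<gamma> \<gamma>''"
        unfolding J_def by blast
      then show "growth c lam T / C - 1 \<le> x"
        using bound[of \<gamma> \<gamma>' \<gamma>''] C0 by (simp add: field_simps)
    qed
    then show ?thesis using C0 by (simp add: field_simps)
  qed
  then show ?thesis by (intro exI[of _ C]) (auto simp: C_def)
qed

end
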